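(* Let $G$ be a finite simple graph. Then $$b_3(G)=\sum_{j=1}^{23}\beta_3(G_j)\left|\binom{G}{G_j}\right|,$$ where $G_1,\dots,G_{23}$ are the following graphs: $G_1=K_2$; $G_2=3K_1$; $G_3=K_2+K_1$; $G_4=P_3$ (path on 3 vertices); $G_5=K_3$; $G_6=P_3+K_1$; $G_7=P_4$ (path on 4 vertices); $G_8=C_4$; $G_9=K_3+K_1$; $G_{10}=K_{1,3}$; $G_{11}$ = a triangle with one pendant edge attached (4 vertices, 4 edges); $G_{12}=K_4$ minus one edge; $G_{13}=K_4$; and, on the vertex set $\{A,B,C,D,E\}$: $G_{14}$ with edges $DE,EA,AB,BC,CE,DB$ (that is, $K_{2,3}$); $G_{15}$ with edges $DE,EA,AB,BC,CE,DB,EB$ (that is, $K_{1,1,3}$); $G_{16}$ the 5-cycle with edges $DE,EA,AB,BC,CD$; $G_{17}$ the 5-cycle $G_{16}$ with the additional edge $CE$; $G_{18}$ the 5-cycle $G_{16}$ with the additional edges $CE,EB$; $G_{19}$ the 5-cycle $G_{16}$ with the additional edges $CE,BD$; $G_{20}$ the 5-cycle $G_{16}$ with the additional edges $CE,EB,BD$; $G_{21}$ the 5-cycle $G_{16}$ with the additional edges $CE,EB,DA$; $G_{22}$ the 5-cycle $G_{16}$ with the additional edges $CE,EB,DA,BD$ (that is, $K_5$ minus one edge); $G_{23}=K_5$.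
   Context: For a finite simple graph $G$ with vertex set $V(G)=\{1,\dots,n\}$ (or any finite totally ordered set) and edge set $E(G)$, the Dani-Mainkar Lie algebra $\mathcal L(G)$ is the real 2-step nilpotent Lie algebra with basis $x_i$ ($i\in V(G)$) and $x_{i,j}$ ($\{i,j\}\in E(G)$, $i<j$), with $[x_i,x_j]=x_{i,j}=-[x_j,x_i]$ if $\{i,j\}\in E(G)$ and $i<j$, all other brackets of basis elements being zero. $\mathcal C^\bullet(G)$ is the Cartan-Chevalley-Eilenberg complex of $\mathcal L(G)$ (trivial real coefficients): the exterior algebra on the dual basis $x_i^*$, $x_{i,j}^*$ (all in degree 1), with differential the odd derivation $Q$ such that $Q(x_i^* )=0$ and $Q(x_{i,j}^* )=x_i^*x_j^*$ for $i<j$. Its cohomology is $H^\bullet(\mathcal L(G))$, and $b_i(G)=\dim H^i(\mathcal L(G))$. For $S\subseteq V(G)$, $\mathcal C^\bullet(G,S)\subseteq\mathcal C^\bullet(G)$ is the subcomplex spanned by all monomials $x_{i_1}^*\cdots x_{i_p}^*x_{r_1,s_1}^*\cdots x_{r_q,s_q}^*$ with $i_a\in V(G)$, $\{r_b,s_b\}\in E(G)$ and $\{i_1,\dots,i_p,r_1,s_1,\dots,r_q,s_q\}=S$ as sets (repetitions of vertices allowed). The essential cohomology of a finite simple graph $H$ is $\mathcal H^\bullet(H)$, the cohomology of $\mathcal C^\bullet(H,V(H))$, and $\beta_i(H)=\dim\mathcal H^i(H)$. $\left|\binom{G}{H}\right|$ denotes the number of occurrences of $H$ as an induced subgraph of $G$,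 i.e. the number of subsets $S\subseteq V(G)$ such that the induced subgraph $G[S]$ is isomorphic to $H$. $H_1+H_2$ denotes disjoint union of graphs, and $mK_1$ is the edgeless graph on $m$ vertices. *)

theory Defs
  imports Complex_Main
begin

section \<open>The exterior algebra on a linearly ordered set of generators\<close>

text \<open>
  An element is stored by its coefficients with respect to the monomials
  \<open>g\<^sub>1 \<dots> g\<^sub>k\<close> with \<open>g\<^sub>1 < \<dots> < g\<^sub>k\<close>; such a monomial is encoded by the finite set
  \<open>{g\<^sub>1, \<dots>, g\<^sub>k}\<close>.
\<close>

typedef 'g ext = "{f :: 'g set \<Rightarrow> real. finite {A. f A \<noteq> 0} \<and> (\<forall>A. f A \<noteq> 0 \<longrightarrow> finite A)}"
  morphisms coeff Abs_ext
  by (rule exI[of _ "\<lambda>_. 0"]) simp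

setup_lifting type_definition_ext

lemma ext_eqI: "(\<And>A. coeff x A = coeff y A) \<Longrightarrow> x = y"
  by transfer auto

lemma finite_coeff: "finite {A. coeff x A \<noteq> 0}"
  by transfer auto

lemma coeff_infinite: "infinite A \<Longrightarrow> coeff x A = 0"
  by transfer auto

text \<open>The sign of the permutation that sorts the concatenation of the sorted lists of the
  disjoint sets \<open>A\<close> and \<open>B\<close>.\<close>

definition wsign :: "'g::linorder set \<Rightarrow> 'g set \<Rightarrow> real" where
  "wsign A B = (-1) ^ card {(a, b). a \<in> A \<and> b \<in> B \<and> b < a}"

lemma wsign_empty [simp]: "wsign {} B = 1" "wsign A {} = 1"
  by (simp_all add: wsign_def)

lemma finite_inversions:
  assumes "finite A" "finite B"
  shows "finite {(a, b). a \<in> A \<and> b \<in> B \<and> b < a}"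
  by (rule finite_subset[of _ "A \<times> B"]) (use assms in auto)

lemma wsign_Un_left:
  assumes "finite A" "finite B" "finite C" "A \<inter> B = {}"
  shows "wsign (A \<union> B) C = wsign A C * wsign B C"
proof -
  have "{(a, b). a \<in> A \<union> B \<and> b \<in> C \<and> b < a} =
      {(a, b). a \<in> A \<and> b \<in> C \<and> b < a} \<union> {(a, b). a \<in> B \<and> b \<in> C \<and> b < a}" by auto
  moreover have "{(a, b). a \<in> A \<and> b \<in> C \<and> b < a} \<inter> {(a, b). a \<in> B \<and> b \<in> C \<and> b < a} = {}"
    using assms(4) by auto
  ultimately show ?thesis
    using assms by (simp add: wsign_def card_Un_disjoint finite_inversions power_add)
qed

lemma wsign_Un_right:
  assumes "finite A" "finite B" "finite C" "B \<inter> C = {}"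
  shows "wsign A (B \<union> C) = wsign A B * wsign A C"
proof -
  have "{(a, b). a \<in> A \<and> b \<in> B \<union> C \<and> b < a} =
      {(a, b). a \<in> A \<and> b \<in> B \<and> b < a} \<union> {(a, b). a \<in> A \<and> b \<in> C \<and> b < a}" by auto
  moreover have "{(a, b). a \<in> A \<and> b \<in> B \<and> b < a} \<inter> {(a, b). a \<in> A \<and> b \<in> C \<and> b < a} = {}"
    using assms(4) by auto
  ultimately show ?thesis
    using assms by (simp add: wsign_def card_Un_disjoint finite_inversions power_add)
qed

instantiation ext :: (type) real_vector
begin

lift_definition zero_ext :: "'a ext" is "\<lambda>_. 0" by simp

lift_definition plus_ext :: "'a ext \<Rightarrow> 'a ext \<Rightarrow> 'a ext" is "\<lambda>f g A. f A + g A"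
proof (intro conjI)
  fix f g :: "'a set \<Rightarrow> real"
  assume f: "finite {A. f A \<noteq> 0} \<and> (\<forall>A. f A \<noteq> 0 \<longrightarrow> finite A)"
    and g: "finite {A. g A \<noteq> 0} \<and> (\<forall>A. g A \<noteq> 0 \<longrightarrow> finite A)"
  show "finite {A. f A + g A \<noteq> 0}"
    by (rule finite_subset[of _ "{A. f A \<noteq> 0} \<union> {A. g A \<noteq> 0}"]) (use f g in auto)
  show "\<forall>A. f A + g A \<noteq> 0 \<longrightarrow> finite A" using f g by (metis add_0)
qed

lift_definition uminus_ext :: "'a ext \<Rightarrow> 'a ext" is "\<lambda>f A. - f A" by simp

definition minus_ext :: "'a ext \<Rightarrow> 'a ext \<Rightarrow> 'a ext" where "minus_ext x y = x + - y"

lift_definition scaleR_ext :: "real \<Rightarrow> 'a ext \<Rightarrow> 'a ext" is "\<lambda>c f A. c * f A"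
  by (auto intro: rev_finite_subset)

instance
  by standard
    (auto simp: minus_ext_def fun_eq_iff algebra_simps plus_ext.rep_eq scaleR_ext.rep_eq
      zero_ext.rep_eq uminus_ext.rep_eq intro!: ext_eqI)

end

lemma coeff_simps [simp]:
  "coeff 0 A = 0" "coeff (x + y) A = coeff x A + coeff y A" "coeff (- x) A = - coeff x A"
  "coeff (x - y) A = coeff x A - coeff y A" "coeff (c *\<^sub>R x) A = c * coeff x A"
  by (simp_all only: minus_ext_def plus_ext.rep_eq scaleR_ext.rep_eq zero_ext.rep_eq
      uminus_ext.rep_eq)

lemma coeff_sum [simp]: "coeff (sum f I) A = (\<Sum>i\<in>I. coeff (f i) A)"
  by (induction I rule: infinite_finite_induct) auto

instantiation ext :: (linorder) real_algebra_1
begin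

lift_definition one_ext :: "'a ext" is "\<lambda>A. if A = {} then 1 else 0" by simp

lift_definition times_ext :: "'a ext \<Rightarrow> 'a ext \<Rightarrow> 'a ext" is
  "\<lambda>f g C. \<Sum>A\<in>Pow C. wsign A (C - A) * f A * g (C - A)"
proof (intro conjI)
  fix f g :: "'a set \<Rightarrow> real"
  let ?P = "\<lambda>C. \<Sum>A\<in>Pow C. wsign A (C - A) * f A * g (C - A)"
  assume f: "finite {A. f A \<noteq> 0} \<and> (\<forall>A. f A \<noteq> 0 \<longrightarrow> finite A)"
    and g: "finite {A. g A \<noteq> 0} \<and> (\<forall>A. g A \<noteq> 0 \<longrightarrow> finite A)"
  have "{C. ?P C \<noteq> 0} \<subseteq> (\<lambda>(A, B). A \<union> B) ` ({A. f A \<noteq> 0} \<times> {A. g A \<noteq> 0})"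
  proof
    fix C assume "C \<in> {C. ?P C \<noteq> 0}"
    then obtain A where A: "A \<in> Pow C" "wsign A (C - A) * f A * g (C - A) \<noteq> 0"
      by (metis (mono_tags, lifting) mem_Collect_eq sum.neutral)
    then have "C = A \<union> (C - A)" "f A \<noteq> 0" "g (C - A) \<noteq> 0" by auto
    then show "C \<in> (\<lambda>(A, B). A \<union> B) ` ({A. f A \<noteq> 0} \<times> {A. g A \<noteq> 0})"
      by (intro image_eqI[of _ _ "(A, C - A)"]) auto
  qed
  then show "finite {C. ?P C \<noteq> 0}" by (rule finite_subset) (use f g in auto)
  show "\<forall>C. ?P C \<noteq> 0 \<longrightarrow> finite C" by (metis finite_Pow_iff sum.infinite)
qed

instance
proof
  fix x y z :: "'a ext" and c :: real
  note rep = times_ext.rep_eq one_ext.rep_eq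
  show "x * y * z = x * (y * z)"
  proof (rule ext_eqI)
    fix D :: "'a set"
    show "coeff (x * y * z) D = coeff (x * (y * z)) D"
    proof (cases "finite D")
      case False
      then show ?thesis by (simp add: coeff_infinite)
    next
      case fin: True
      let ?l = "\<lambda>E A. wsign E (D - E) * (wsign A (E - A) * coeff x A * coeff y (E - A)) * coeff z (D - E)"
      let ?r = "\<lambda>A B. wsign A (D - A) * coeff x A *
        (wsign B (D - A - B) * coeff y B * coeff z (D - A - B))"
      have "coeff (x * y * z) D = (\<Sum>E\<in>Pow D. \<Sum>A\<in>Pow E. ?l E A)"
        by (simp add: rep sum_distrib_left sum_distrib_right)
      also have "\<dots> = (\<Sum>(E, A)\<in>Sigma (Pow D) Pow. ?l E A)"
        by (rule sum.Sigma) (use fin in \<open>auto intro: finite_subset\<close>)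
      also have "\<dots> = (\<Sum>(A, B)\<in>Sigma (Pow D) (\<lambda>A. Pow (D - A)). ?r A B)"
      proof (rule sum.reindex_bij_witness[of _ "\<lambda>(A, B). (A \<union> B, A)" "\<lambda>(E, A). (A, E - A)"])
        fix p assume p: "p \<in> Sigma (Pow D) Pow"
        obtain E A where EA: "p = (E, A)" "A \<subseteq> E" "E \<subseteq> D" using p by auto
        define B where "B = E - A"
        define C where "C = D - E"
        have f: "finite A" "finite B" "finite C"
          using EA fin by (auto simp: B_def C_def intro: finite_subset)
        have e: "E = A \<union> B" "D - A = B \<union> C" "D - A - B = C" "E - A = B" "D - E = C"
          and d: "A \<inter> B = {}" "B \<inter> C = {}"
          using EA by (auto simp: B_def C_def)
        have "wsign E C * wsign A B = wsign A (B \<union> C) * wsign B C"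
          unfolding e(1) using f d by (simp add: wsign_Un_left wsign_Un_right)
        then have "?r A B = ?l E A"
          unfolding e(3) unfolding e(2,4,5) by algebra
        then show "(case case p of (E, A) \<Rightarrow> (A, E - A) of (A, B) \<Rightarrow> ?r A B) =
            (case p of (E, A) \<Rightarrow> ?l E A)"
          by (simp add: EA(1) B_def)
      qed auto
      also have "\<dots> = (\<Sum>A\<in>Pow D. \<Sum>B\<in>Pow (D - A). ?r A B)"
        by (rule sum.Sigma[symmetric]) (use fin in \<open>auto intro: finite_subset\<close>)
      also have "\<dots> = coeff (x * (y * z)) D"
        by (simp add: rep sum_distrib_left)
      finally show ?thesis .
    qed
  qed
  show "(x + y) * z = x * z + y * z" "x * (y + z) = x * y + x * z"
    "(c *\<^sub>R x) * y = c *\<^sub>R (x * y)" "x * (c *\<^sub>R y) = c *\<^sub>R (x * y)"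
    by (rule ext_eqI; simp add: rep algebra_simps sum.distrib sum_distrib_left)+
  show "1 * x = x"
  proof (rule ext_eqI)
    fix C :: "'a set"
    have "finite C \<Longrightarrow> coeff (1 * x) C = (\<Sum>A\<in>{{}}. wsign A (C - A) * coeff 1 A * coeff x (C - A))"
      unfolding rep by (rule sum.mono_neutral_right) auto
    then show "coeff (1 * x) C = coeff x C"
      by (cases "finite C") (auto simp: coeff_infinite one_ext.rep_eq)
  qed
  show "x * 1 = x"
  proof (rule ext_eqI)
    fix C :: "'a set"
    have "finite C \<Longrightarrow> coeff (x * 1) C = (\<Sum>A\<in>{C}. wsign A (C - A) * coeff x A * coeff 1 (C - A))"
      unfolding rep by (rule sum.mono_neutral_right) auto
    then show "coeff (x * 1) C = coeff x C"
      by (cases "finite C") (auto simp: coeff_infinite one_ext.rep_eq)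
  qed
  show "(0 :: 'a ext) \<noteq> 1"
    by (metis coeff_simps(1) one_ext.rep_eq zero_neq_one)
qed

end

lift_definition mono_ext :: "'g set \<Rightarrow> 'g ext" is "\<lambda>A B. if B = A \<and> finite A then 1 else 0"
  by auto

definition gen :: "'g \<Rightarrow> 'g ext" where
  "gen g = mono_ext {g}"

lemma coeff_mono_ext: "coeff (mono_ext A) B = (if B = A \<and> finite A then 1 else 0)"
  by (simp add: mono_ext.rep_eq)

lemma mono_ext_empty: "mono_ext {} = 1"
  by (rule ext_eqI) (simp add: coeff_mono_ext one_ext.rep_eq)

lemma mono_ext_mult:
  assumes "finite A" "finite B"
  shows "mono_ext A * mono_ext B = (if A \<inter> B = {} then wsign A B *\<^sub>R mono_ext (A \<union> B) else 0)"
proof (rule ext_eqI)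
  fix C :: "'a set"
  show "coeff (mono_ext A * mono_ext B) C =
    coeff (if A \<inter> B = {} then wsign A B *\<^sub>R mono_ext (A \<union> B) else 0) C"
  proof (cases "finite C \<and> A \<subseteq> C")
    case True
    have "coeff (mono_ext A * mono_ext B) C =
        (\<Sum>D\<in>{A}. wsign D (C - D) * coeff (mono_ext A) D * coeff (mono_ext B) (C - D))"
      unfolding times_ext.rep_eq by (rule sum.mono_neutral_right) (use True in \<open>auto simp: coeff_mono_ext\<close>)
    moreover have "C - A = B \<longleftrightarrow> A \<inter> B = {} \<and> C = A \<union> B" using True by auto
    ultimately show ?thesis using assms by (auto simp: coeff_mono_ext)
  next
    case False
    have "coeff (mono_ext A * mono_ext B) C = 0"
    proof (cases "finite C")
      case True
      then show ?thesis using False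
        unfolding times_ext.rep_eq by (intro sum.neutral) (auto simp: coeff_mono_ext)
    qed (simp add: coeff_infinite)
    then show ?thesis using False assms by (auto simp: coeff_mono_ext)
  qed
qed

lemma gen_square: "gen g * gen g = 0"
  by (simp add: gen_def mono_ext_mult)

lemma gen_anticommute: "gen g * gen h = - (gen h * gen g)"
proof (cases "g = h")
  case False
  have *: "wsign {g} {h} = (if h < g then -1 else 1)" for g h :: 'a
  proof -
    have "{(a, b). a \<in> {g} \<and> b \<in> {h} \<and> b < a} = (if h < g then {(g, h)} else {})" by auto
    then show ?thesis by (simp add: wsign_def)
  qed
  show ?thesis using False
    by (auto simp: gen_def mono_ext_mult * insert_commute)
qed (simp add: gen_square)

text \<open>The monomial written out as a product, with repetitions and in any order.\<close>

definition gens_prod :: "'g::linorder list \<Rightarrow> 'g ext" where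
  "gens_prod gs = prod_list (map gen gs)"

lemma gens_prod_simps [simp]:
  "gens_prod [] = 1" "gens_prod (g # gs) = gen g * gens_prod gs"
  "gens_prod (gs @ hs) = gens_prod gs * gens_prod hs"
  by (simp_all add: gens_prod_def)

lemma gens_prod_sorted: "sorted gs \<Longrightarrow> distinct gs \<Longrightarrow> gens_prod gs = mono_ext (set gs)"
proof (induction gs)
  case (Cons g gs)
  have "{(a, b). a \<in> {g} \<and> b \<in> set gs \<and> b < a} = {}"
    using Cons.prems by auto
  then have "wsign {g} (set gs) = 1" by (simp only: wsign_def card.empty power_0)
  then show ?case using Cons by (simp add: gen_def mono_ext_mult)
qed (simp add: mono_ext_empty)

lemma mono_ext_gens_prod: "finite A \<Longrightarrow> mono_ext A = gens_prod (sorted_list_of_set A)"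
  by (simp add: gens_prod_sorted)

lemma ext_expand: "x = (\<Sum>A | coeff x A \<noteq> 0. coeff x A *\<^sub>R mono_ext A)"
proof (rule ext_eqI)
  fix B
  have "(\<Sum>A | coeff x A \<noteq> 0. coeff x A * coeff (mono_ext A) B) =
      (\<Sum>A | coeff x A \<noteq> 0. if A = B then coeff x B else 0)"
    by (rule sum.cong) (auto simp: coeff_mono_ext coeff_infinite)
  then show "coeff x B = coeff (\<Sum>A | coeff x A \<noteq> 0. coeff x A *\<^sub>R mono_ext A) B"
    using finite_coeff[of x] by simp
qed

lemma ext_span_mono: "x \<in> span (mono_ext ` Collect finite)"
proof -
  have "(\<Sum>A | coeff x A \<noteq> 0. coeff x A *\<^sub>R mono_ext A) \<in> span (mono_ext ` Collect finite)"
    by (intro span_sum span_scale span_base) (auto intro: coeff_infinite)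
  then show ?thesis by (simp flip: ext_expand)
qed

lemma ext_span_gens_prod: "x \<in> span (range gens_prod)"
proof -
  have "mono_ext ` Collect finite \<subseteq> range gens_prod"
    by (auto simp: mono_ext_gens_prod)
  then show ?thesis using ext_span_mono span_mono by blast
qed


section \<open>The odd derivation with prescribed values on the generators\<close>

text \<open>
  \<open>der_prod q [g\<^sub>1, \<dots>, g\<^sub>k]\<close> is the Leibniz expansion of the derivative of \<open>g\<^sub>1 \<dots> g\<^sub>k\<close>; it is
  evaluated on sorted monomials and extended linearly. For even values \<open>q g\<close> the result is the
  unique odd derivation with \<open>g \<mapsto> q g\<close>, see \<open>odd_derivation_mult\<close>, \<open>odd_derivation_gen\<close> and
  \<open>odd_derivation_unique\<close> below.
\<close>

fun der_prod :: "('g::linorder \<Rightarrow> 'g ext) \<Rightarrow> 'g list \<Rightarrow> 'g ext" where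
  "der_prod q [] = 0"
| "der_prod q (g # gs) = q g * gens_prod gs - gen g * der_prod q gs"

definition odd_derivation :: "('g::linorder \<Rightarrow> 'g ext) \<Rightarrow> 'g ext \<Rightarrow> 'g ext" where
  "odd_derivation q x = (\<Sum>A | coeff x A \<noteq> 0. coeff x A *\<^sub>R der_prod q (sorted_list_of_set A))"

lemma odd_derivation_linear: "linear (odd_derivation q)"
proof
  have superset: "odd_derivation q x = (\<Sum>A\<in>S. coeff x A *\<^sub>R der_prod q (sorted_list_of_set A))"
    if "finite S" "{A. coeff x A \<noteq> 0} \<subseteq> S" for x S
    unfolding odd_derivation_def by (rule sum.mono_neutral_left) (use that in auto)
  fix x y :: "'a ext" and c :: real
  let ?S = "{A. coeff x A \<noteq> 0} \<union> {A. coeff y A \<noteq> 0}"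
  have S: "finite ?S" by (simp add: finite_coeff)
  show "odd_derivation q (x + y) = odd_derivation q x + odd_derivation q y"
    by (subst (1 2 3) superset[OF S]) (auto simp: scaleR_add_left sum.distrib)
  show "odd_derivation q (c *\<^sub>R x) = c *\<^sub>R odd_derivation q x"
    by (subst (1 2) superset[OF finite_coeff[of x]]) (auto simp: scaleR_sum_right)
qed

lemma odd_derivation_mono:
  assumes "finite A"
  shows "odd_derivation q (mono_ext A) = der_prod q (sorted_list_of_set A)"
proof -
  have "{B. coeff (mono_ext A) B \<noteq> 0} = {A}" using assms by (auto simp: coeff_mono_ext)
  then show ?thesis using assms by (simp add: odd_derivation_def coeff_mono_ext)
qed

context
  fixes q :: "'g::linorder \<Rightarrow> 'g ext"
  assumes even: "\<And>g h. q g * gen h = gen h * q g"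
begin

lemma der_prod_swap: "der_prod q (g # h # gs) = - der_prod q (h # g # gs)"
proof -
  have "gen g * (gen h * x) = - (gen h * (gen g * x))" for x :: "'g ext"
    using gen_anticommute[of g h] by (simp flip: mult.assoc)
  moreover have "q g * (gen h * x) = gen h * (q g * x)" for g h x
    using even[of g h] by (simp flip: mult.assoc)
  ultimately show ?thesis by (simp add: algebra_simps)
qed

lemma der_prod_repeat: "der_prod q (g # g # gs) = 0"
proof -
  have "gen g * (gen g * x) = 0" for x :: "'g ext"
    using gen_square[of g] by (simp flip: mult.assoc)
  moreover have "q g * (gen h * x) = gen h * (q g * x)" for g h x
    using even[of g h] by (simp flip: mult.assoc)
  ultimately show ?thesis by (simp add: algebra_simps)
qed

lemma gens_prod_swap: "gens_prod (g # h # gs) = - gens_prod (h # g # gs)"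
  using gen_anticommute[of g h] by (simp flip: mult.assoc)

lemma insort_sign:
  "\<exists>c. gens_prod (g # gs) = c *\<^sub>R gens_prod (insort g gs) \<and>
       der_prod q (g # gs) = c *\<^sub>R der_prod q (insort g gs)"
proof (induction gs)
  case (Cons h gs)
  then obtain c where c: "gens_prod (g # gs) = c *\<^sub>R gens_prod (insort g gs)"
    "der_prod q (g # gs) = c *\<^sub>R der_prod q (insort g gs)" by blast
  show ?case
  proof (cases "g \<le> h")
    case False
    have "gens_prod (g # h # gs) = - (gen h * gens_prod (g # gs))"
      by (subst gens_prod_swap) simp
    then have 1: "gens_prod (g # h # gs) = (- c) *\<^sub>R (gen h * gens_prod (insort g gs))"
      by (simp only: c) simp
    have "der_prod q (g # h # gs) = - (q h * gens_prod (g # gs) - gen h * der_prod q (g # gs))"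
      by (subst der_prod_swap) simp
    then have "der_prod q (g # h # gs) =
        (- c) *\<^sub>R (q h * gens_prod (insort g gs) - gen h * der_prod q (insort g gs))"
      by (simp only: c) (simp add: algebra_simps)
    then show ?thesis using False 1 by (intro exI[of _ "- c"]) simp
  qed (intro exI[of _ 1], simp)
qed (intro exI[of _ 1], simp)

lemma der_prod_insort:
  "sorted gs \<Longrightarrow> g \<in> set gs \<Longrightarrow> gens_prod (g # gs) = 0 \<and> der_prod q (g # gs) = 0"
proof (induction gs)
  case (Cons h gs)
  show ?case
  proof (cases "g = h")
    case True
    then show ?thesis using der_prod_repeat[of g gs] gen_square[of g]
      by (simp flip: mult.assoc)
  next
    case False
    then have IH: "gens_prod (g # gs) = 0" "der_prod q (g # gs) = 0" using Cons by auto
    have "gens_prod (g # h # gs) = - (gen h * gens_prod (g # gs))"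
      by (subst gens_prod_swap) simp
    moreover have "der_prod q (g # h # gs) = - (q h * gens_prod (g # gs) - gen h * der_prod q (g # gs))"
      by (subst der_prod_swap) simp
    ultimately show ?thesis by (simp only: IH) simp
  qed
qed simp

lemma odd_derivation_gen_mult:
  "odd_derivation q (gen g * x) = q g * x - gen g * odd_derivation q x"
proof -
  interpret D: linear "odd_derivation q" by (rule odd_derivation_linear)
  have mono: "odd_derivation q (gen g * mono_ext A) = q g * mono_ext A - gen g * odd_derivation q (mono_ext A)"
    if A: "finite A" for A
  proof -
    define gs where "gs = sorted_list_of_set A"
    have gs: "sorted gs" "distinct gs" "set gs = A" using A by (simp_all add: gs_def)
    have rhs: "q g * mono_ext A - gen g * odd_derivation q (mono_ext A) = der_prod q (g # gs)"
      using A by (simp add: odd_derivation_mono gs_def) (simp add: mono_ext_gens_prod)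
    have lhs: "gen g * mono_ext A = gens_prod (g # gs)"
      using A by (simp add: mono_ext_gens_prod gs_def)
    show ?thesis
    proof (cases "g \<in> A")
      case True
      then show ?thesis unfolding rhs lhs
        using der_prod_insort[of gs g] gs by (simp only: D.zero)
    next
      case False
      obtain c where c: "gens_prod (g # gs) = c *\<^sub>R gens_prod (insort g gs)"
        "der_prod q (g # gs) = c *\<^sub>R der_prod q (insort g gs)" using insort_sign by blast
      have ins: "insort g gs = sorted_list_of_set (insert g A)"
        using False A by (simp add: gs_def)
      have "odd_derivation q (gens_prod (insort g gs)) = der_prod q (insort g gs)"
        unfolding ins using A odd_derivation_mono[of "insert g A" q]
        by (simp only: mono_ext_gens_prod finite_insert)
      then show ?thesis unfolding rhs lhs by (simp only: c D.scale)
    qed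
  qed
  have "linear (\<lambda>x. odd_derivation q (gen g * x))"
    by (rule linearI) (simp_all add: algebra_simps D.add D.scale)
  moreover have "linear (\<lambda>x. q g * x - gen g * odd_derivation q x)"
    by (rule linearI) (simp_all add: algebra_simps D.add D.scale)
  ultimately show ?thesis
    using linear_eq_on_span[of "\<lambda>x. odd_derivation q (gen g * x)"
        "\<lambda>x. q g * x - gen g * odd_derivation q x" "mono_ext ` Collect finite" x]
      mono ext_span_mono by auto
qed

lemma odd_derivation_gens_prod: "odd_derivation q (gens_prod gs) = der_prod q gs"
  by (induction gs)
    (simp_all add: odd_derivation_gen_mult odd_derivation_mono flip: mono_ext_empty)

lemma odd_derivation_gen: "odd_derivation q (gen g) = q g"
  using odd_derivation_gens_prod[of "[g]"] by simp

text \<open>The graded Leibniz rule.\<close>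

lemma odd_derivation_mult:
  "odd_derivation q (gens_prod gs * x) =
    odd_derivation q (gens_prod gs) * x + (-1) ^ length gs * (gens_prod gs * odd_derivation q x)"
proof (induction gs)
  case Nil
  then show ?case using odd_derivation_gens_prod[of "[]"] by simp
next
  case (Cons g gs)
  have "gen g * ((-1) ^ n * y) = (-1) ^ n * (gen g * y)" for n :: nat and y :: "'g ext"
    by (cases "even n") auto
  then show ?case
    by (simp add: mult.assoc odd_derivation_gen_mult Cons.IH algebra_simps)
qed

lemma odd_derivation_unique:
  assumes "linear D" "D 1 = 0" and D: "\<And>g x. D (gen g * x) = q g * x - gen g * D x"
  shows "D = odd_derivation q"
proof -
  have "D (gens_prod gs) = odd_derivation q (gens_prod gs)" for gs
    unfolding odd_derivation_gens_prod by (induction gs) (simp_all add: assms(2) D)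
  then show ?thesis
    using linear_eq_on_span[OF assms(1) odd_derivation_linear, of "range gens_prod"]
      ext_span_gens_prod by blast
qed

lemma odd_derivation_square:
  assumes "\<And>g. odd_derivation q (q g) = 0"
    and leibniz: "\<And>g x. odd_derivation q (q g * x) = odd_derivation q (q g) * x + q g * odd_derivation q x"
  shows "odd_derivation q (odd_derivation q x) = 0"
proof -
  interpret D: linear "odd_derivation q" by (rule odd_derivation_linear)
  have "odd_derivation q (odd_derivation q (gens_prod gs)) = 0" for gs
  proof (induction gs)
    case Nil
    then show ?case using odd_derivation_gens_prod[of "[]"] by (simp add: D.zero)
  next
    case (Cons g gs)
    then show ?case by (simp add: odd_derivation_gen_mult D.diff leibniz assms(1))
  qed
  moreover have "linear (\<lambda>x. odd_derivation q (odd_derivation q x))"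
    by (rule linearI) (simp_all add: D.add D.scale)
  moreover have "linear (\<lambda>x. 0 :: 'g ext)"
    by (rule linearI) simp_all
  ultimately show ?thesis
    using linear_eq_on_span[of "\<lambda>x. odd_derivation q (odd_derivation q x)" "\<lambda>_. 0"
        "range gens_prod" x] ext_span_gens_prod by auto
qed

end


section \<open>Cohomology of a cochain complex of real vector spaces\<close>

text \<open>The classes of the elements of \<open>D\<close> form a basis of \<open>Z / B\<close>
  (and distinct elements of \<open>D\<close> have distinct classes).\<close>

definition quotient_basis :: "'a::real_vector set \<Rightarrow> 'a set \<Rightarrow> 'a set \<Rightarrow> bool" where
  "quotient_basis Z B D \<longleftrightarrow> D \<subseteq> Z
    \<and> (\<forall>F c. finite F \<and> F \<subseteq> D \<and> (\<Sum>d\<in>F. c d *\<^sub>R d) \<in> B \<longrightarrow> (\<forall>d\<in>F. c d = 0))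
    \<and> (\<forall>z\<in>Z. \<exists>u\<in>span D. z - u \<in> B)"

definition quotient_dim :: "'a::real_vector set \<Rightarrow> 'a set \<Rightarrow> nat" where
  "quotient_dim Z B = card (SOME D. quotient_basis Z B D)"

lemma quotient_basis_exists:
  fixes Z B :: "'a::real_vector set"
  assumes Z: "subspace Z" and B: "subspace B" "B \<subseteq> Z"
  shows "\<exists>D. quotient_basis Z B D"
proof -
  obtain E where E: "E \<subseteq> B" "independent E" "B \<subseteq> span E"
    by (rule basis_exists)
  obtain E' where E': "E \<subseteq> E'" "E' \<subseteq> Z" "independent E'" "Z \<subseteq> span E'"
    by (rule maximal_independent_subset_extend[of E Z]) (use E B(2) in auto)
  have spB: "span E = B" using E B(1) by (simp add: span_subspace)
  define D where "D = E' - E"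
  have E'_eq: "E' = E \<union> D" using E'(1) by (auto simp: D_def)
  have "\<forall>d\<in>F. c d = 0" if F: "finite F" "F \<subseteq> D" "(\<Sum>d\<in>F. c d *\<^sub>R d) \<in> B" for F c
  proof (rule ballI, rule ccontr)
    fix d assume d: "d \<in> F" "c d \<noteq> 0"
    have "c d *\<^sub>R d = (\<Sum>d\<in>F. c d *\<^sub>R d) - (\<Sum>d\<in>F - {d}. c d *\<^sub>R d)"
      using F(1) d(1) by (simp add: sum.remove)
    moreover have "(\<Sum>d\<in>F. c d *\<^sub>R d) \<in> span (E' - {d})"
    proof -
      have "E \<subseteq> E' - {d}" using d(1) F(2) E'(1) by (auto simp: D_def)
      then show ?thesis using F(3) spB span_mono by blast
    qed
    moreover have "(\<Sum>d\<in>F - {d}. c d *\<^sub>R d) \<in> span (E' - {d})"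
      using F(2) by (intro span_sum span_scale span_base) (auto simp: D_def)
    ultimately have "c d *\<^sub>R d \<in> span (E' - {d})" by (metis span_diff)
    then have "inverse (c d) *\<^sub>R (c d *\<^sub>R d) \<in> span (E' - {d})" by (rule span_scale)
    then have "d \<in> span (E' - {d})" using d(2) by simp
    then show False using E'(3) d(1) F(2) by (auto simp: D_def dependent_def)
  qed
  moreover have "\<exists>u\<in>span D. z - u \<in> B" if "z \<in> Z" for z
  proof -
    have "z \<in> span (E \<union> D)" using that E'(4) E'_eq by auto
    then obtain b u where "z = b + u" "b \<in> span E" "u \<in> span D"
      unfolding span_Un by auto
    then show ?thesis using spB by (intro bexI[of _ u]) auto
  qed
  ultimately have "quotient_basis Z B D"
    using E'(2) unfolding quotient_basis_def by (auto simp: D_def)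
  then show ?thesis ..
qed

lemma quotient_basis_card:
  fixes Z B :: "'a::real_vector set"
  assumes Z: "subspace Z" and B: "subspace B" "B \<subseteq> Z"
    and fin: "finite W" "Z \<subseteq> span W" and D: "quotient_basis Z B D"
  shows "card D + dim B = dim Z"
proof -
  obtain E where E: "E \<subseteq> B" "independent E" "B \<subseteq> span E" "card E = dim B"
    by (rule basis_exists)
  have spB: "span E = B" using E B(1) by (simp add: span_subspace)
  have DZ: "D \<subseteq> Z" and lin: "\<And>F c. finite F \<Longrightarrow> F \<subseteq> D \<Longrightarrow> (\<Sum>d\<in>F. c d *\<^sub>R d) \<in> B \<Longrightarrow> \<forall>d\<in>F. c d = 0"
    and gen: "\<And>z. z \<in> Z \<Longrightarrow> \<exists>u\<in>span D. z - u \<in> B"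
    using D unfolding quotient_basis_def by blast+
  have disj: "E \<inter> D = {}"
  proof (rule ccontr)
    assume "E \<inter> D \<noteq> {}"
    then obtain e where e: "e \<in> E" "e \<in> D" by auto
    then show False using lin[of "{e}" "\<lambda>_. 1"] E(1) by auto
  qed
  have ind: "independent (E \<union> D)"
    unfolding independent_explicit_module
  proof (intro allI impI)
    fix F c v
    assume F: "finite F" "F \<subseteq> E \<union> D" "(\<Sum>v\<in>F. c v *\<^sub>R v) = 0" "v \<in> F"
    have "(\<Sum>v\<in>F. c v *\<^sub>R v) = (\<Sum>v\<in>F \<inter> E. c v *\<^sub>R v) + (\<Sum>v\<in>F \<inter> D. c v *\<^sub>R v)"
      using F(1,2) disj by (subst sum.union_disjoint[symmetric]) (auto intro: sum.cong)
    then have split: "(\<Sum>v\<in>F \<inter> D. c v *\<^sub>R v) = - (\<Sum>v\<in>F \<inter> E. c v *\<^sub>R v)"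
      using F(3) by (simp add: eq_neg_iff_add_eq_0 add.commute)
    have "(\<Sum>v\<in>F \<inter> E. c v *\<^sub>R v) \<in> B"
      using E(1) B(1) by (intro subspace_sum subspace_scale) auto
    then have "(\<Sum>v\<in>F \<inter> D. c v *\<^sub>R v) \<in> B" unfolding split by (rule subspace_neg[OF B(1)])
    then have cD: "\<forall>v\<in>F \<inter> D. c v = 0" using lin[of "F \<inter> D" c] F(1) by auto
    then have "(\<Sum>v\<in>F \<inter> D. c v *\<^sub>R v) = 0" by (intro sum.neutral) simp
    then have "(\<Sum>v\<in>F \<inter> E. c v *\<^sub>R v) = 0" using split by simp
    then have "\<forall>v\<in>F \<inter> E. c v = 0"
      using E(2) F(1) unfolding independent_explicit_module by (metis Int_lower2 finite_Int)
    then show "c v = 0" using cD F(2,4) by auto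
  qed
  have sub: "E \<union> D \<subseteq> Z" using E(1) B(2) DZ by auto
  have "Z \<subseteq> span (E \<union> D)"
  proof
    fix z assume "z \<in> Z"
    then obtain u where "u \<in> span D" "z - u \<in> span E" using gen spB by blast
    then have "u \<in> span (E \<union> D)" "z - u \<in> span (E \<union> D)"
      by (meson Un_upper1 Un_upper2 span_mono subsetD)+
    then have "u + (z - u) \<in> span (E \<union> D)" by (rule span_add)
    then show "z \<in> span (E \<union> D)" by simp
  qed
  then have "dim Z = card (E \<union> D)" using sub ind by (metis basis_card_eq_dim)
  moreover have "finite (E \<union> D)"
    using independent_span_bound[OF fin(1) ind] sub fin(2) by blast
  ultimately show ?thesis using disj E(4) by (simp add: card_Un_disjoint)
qed

lemma quotient_dim_eq:
  fixes Z B :: "'a::real_vector set"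
  assumes "subspace Z" "subspace B" "B \<subseteq> Z" "finite W" "Z \<subseteq> span W"
  shows "quotient_dim Z B = dim Z - dim B"
proof -
  have "quotient_basis Z B (SOME D. quotient_basis Z B D)"
    using quotient_basis_exists[OF assms(1-3)] by (rule someI_ex)
  from quotient_basis_card[OF assms this] show ?thesis unfolding quotient_dim_def by simp
qed

text \<open>A complex is given by its homogeneous parts \<open>C 0, C 1, \<dots>\<close> inside one ambient space
  and a differential \<open>d\<close> of degree one on that space.\<close>

definition cocycles :: "(nat \<Rightarrow> 'a::real_vector set) \<Rightarrow> ('a \<Rightarrow> 'a) \<Rightarrow> nat \<Rightarrow> 'a set" where
  "cocycles C d k = {z \<in> C k. d z = 0}"

definition coboundaries :: "(nat \<Rightarrow> 'a::real_vector set) \<Rightarrow> ('a \<Rightarrow> 'a) \<Rightarrow> nat \<Rightarrow> 'a set" where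
  "coboundaries C d k = (case k of 0 \<Rightarrow> {0} | Suc j \<Rightarrow> d ` C j)"

definition cohomology_dim :: "(nat \<Rightarrow> 'a::real_vector set) \<Rightarrow> ('a \<Rightarrow> 'a) \<Rightarrow> nat \<Rightarrow> nat" where
  "cohomology_dim C d k = quotient_dim (cocycles C d k) (coboundaries C d k)"

lemma cohomology_dim_eq:
  assumes d: "linear d" "\<And>x. d (d x) = 0" and C: "\<And>k. subspace (C k)" "\<And>k. d ` C k \<subseteq> C (Suc k)"
    and fin: "finite W" "C k \<subseteq> span W"
  shows "cohomology_dim C d k = dim (cocycles C d k) - dim (coboundaries C d k)"
  unfolding cohomology_dim_def
proof (rule quotient_dim_eq[OF _ _ _ fin(1)])
  interpret linear d by (rule d)
  have "cocycles C d k = C k \<inter> {z. d z = 0}" by (auto simp: cocycles_def)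
  then show "subspace (cocycles C d k)"
    by (metis C(1) subspace_inter linear_subspace_kernel[OF d(1)])
  show "subspace (coboundaries C d k)"
    by (auto simp: coboundaries_def C(1) linear_subspace_image[OF d(1)] subspace_single_0
        split: nat.split)
  show "coboundaries C d k \<subseteq> cocycles C d k"
    using C(2) d(2) subspace_0[OF C(1)] zero
    by (auto simp: coboundaries_def cocycles_def split: nat.splits)
  show "cocycles C d k \<subseteq> span W" using fin(2) by (auto simp: cocycles_def)
qed


section \<open>Graphs\<close>

record 'v graph =
  verts :: "'v set"
  edges :: "'v set set"

definition simple_graph :: "'v graph \<Rightarrow> bool" where
  "simple_graph G \<longleftrightarrow> finite (verts G) \<and>
    (\<forall>e\<in>edges G. \<exists>u\<in>verts G. \<exists>v\<in>verts G. u \<noteq> v \<and> e = {u, v})"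

definition induced :: "'v graph \<Rightarrow> 'v set \<Rightarrow> 'v graph" where
  "induced G S = \<lparr>verts = S, edges = {e \<in> edges G. e \<subseteq> S}\<rparr>"

definition graph_iso :: "'v graph \<Rightarrow> 'w graph \<Rightarrow> bool" where
  "graph_iso G H \<longleftrightarrow> (\<exists>f. bij_betw f (verts G) (verts H) \<and>
    (\<forall>u\<in>verts G. \<forall>v\<in>verts G. {u, v} \<in> edges G \<longleftrightarrow> {f u, f v} \<in> edges H))"

definition num_induced :: "'v graph \<Rightarrow> 'w graph \<Rightarrow> nat" where
  "num_induced G H = card {S. S \<subseteq> verts G \<and> graph_iso (induced G S) H}"


section \<open>The Dani--Mainkar Lie algebra and its Cartan--Chevalley--Eilenberg complex\<close>

text \<open>\<open>Vtx i\<close> indexes \<open>x\<^sub>i\<close> and \<open>Edg i j\<close> indexes \<open>x\<^sub>i\<^sub>,\<^sub>j\<close>, which is only used for \<open>i < j\<close>.\<close>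

datatype 'v dm_gen = Vtx 'v | Edg 'v 'v

text \<open>The order fixes the signs in the coefficient representation of the exterior algebra;
  any other linear order gives an isomorphic algebra.\<close>

instantiation dm_gen :: (linorder) linorder
begin

definition less_eq_dm_gen :: "'a dm_gen \<Rightarrow> 'a dm_gen \<Rightarrow> bool" where
  "less_eq_dm_gen x y = (case (x, y) of
      (Vtx i, Vtx j) \<Rightarrow> i \<le> j
    | (Vtx i, Edg k l) \<Rightarrow> True
    | (Edg i j, Vtx k) \<Rightarrow> False
    | (Edg i j, Edg k l) \<Rightarrow> i < k \<or> i = k \<and> j \<le> l)"

definition less_dm_gen :: "'a dm_gen \<Rightarrow> 'a dm_gen \<Rightarrow> bool" where
  "less_dm_gen x y \<longleftrightarrow> x \<le> y \<and> \<not> y \<le> x"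

instance
  by standard (auto simp: less_eq_dm_gen_def less_dm_gen_def split: dm_gen.splits)

end

definition dm_basis :: "'v::linorder graph \<Rightarrow> 'v dm_gen set" where
  "dm_basis G = {Vtx i | i. i \<in> verts G} \<union> {Edg i j | i j. {i, j} \<in> edges G \<and> i < j}"

text \<open>\<open>dm_bracket G a b\<close> is the bracket of the basis elements \<open>a\<close> and \<open>b\<close> of the Lie algebra
  of \<open>G\<close>, as coordinates with respect to \<open>dm_basis G\<close>.\<close>

definition dm_bracket :: "'v::linorder graph \<Rightarrow> 'v dm_gen \<Rightarrow> 'v dm_gen \<Rightarrow> 'v dm_gen \<Rightarrow> real" where
  "dm_bracket G a b = (case (a, b) of
      (Vtx i, Vtx j) \<Rightarrow>
        (if {i, j} \<in> edges G \<and> i < j then (\<lambda>g. if g = Edg i j then 1 else 0)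
         else if {i, j} \<in> edges G \<and> j < i then (\<lambda>g. if g = Edg j i then -1 else 0)
         else (\<lambda>g. 0))
    | _ \<Rightarrow> (\<lambda>g. 0))"

text \<open>
  From here on \<open>gen (Vtx i)\<close> and \<open>gen (Edg i j)\<close> stand for the dual basis elements
  \<open>x\<^sub>i\<^sup>*\<close> and \<open>x\<^sub>i\<^sub>,\<^sub>j\<^sup>*\<close>. The differential does not mention the graph; it is restricted to the
  cochains of a graph by the choice of generators. Its sign convention makes it dual to the
  bracket itself, see \<open>dm_diff_bracket\<close>.
\<close>

fun dm_diff_gen :: "'v::linorder dm_gen \<Rightarrow> 'v dm_gen ext" where
  "dm_diff_gen (Vtx i) = 0"
| "dm_diff_gen (Edg i j) = gen (Vtx i) * gen (Vtx j)"

definition dm_diff :: "'v::linorder dm_gen ext \<Rightarrow> 'v dm_gen ext" where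
  "dm_diff = odd_derivation dm_diff_gen"

fun gen_verts :: "'v dm_gen \<Rightarrow> 'v set" where
  "gen_verts (Vtx i) = {i}"
| "gen_verts (Edg i j) = {i, j}"

definition cochains :: "'v::linorder graph \<Rightarrow> nat \<Rightarrow> 'v dm_gen ext set" where
  "cochains G k = span {gens_prod gs | gs. set gs \<subseteq> dm_basis G \<and> length gs = k}"

definition cochains_on :: "'v::linorder graph \<Rightarrow> 'v set \<Rightarrow> nat \<Rightarrow> 'v dm_gen ext set" where
  "cochains_on G S k = span {gens_prod gs | gs.
    set gs \<subseteq> dm_basis G \<and> length gs = k \<and> (\<Union>g\<in>set gs. gen_verts g) = S}"

definition betti :: "nat \<Rightarrow> 'v::linorder graph \<Rightarrow> nat" where
  "betti i G = cohomology_dim (cochains G) dm_diff i"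

definition essential_betti :: "nat \<Rightarrow> 'v::linorder graph \<Rightarrow> nat" where
  "essential_betti i H = cohomology_dim (cochains_on H (verts H)) dm_diff i"


subsection \<open>These are complexes, and the differential is dual to the bracket\<close>

lemma dm_diff_gen_even: "dm_diff_gen g * gen h = gen h * dm_diff_gen g"
proof (cases g)
  case (Edg i j)
  have "gen (Vtx i) * gen (Vtx j) * gen h = - (gen (Vtx i) * gen h * gen (Vtx j))"
    by (metis gen_anticommute mult.assoc mult_minus_right)
  also have "\<dots> = gen h * (gen (Vtx i) * gen (Vtx j))"
    by (metis gen_anticommute minus_minus mult.assoc mult_minus_left)
  finally show ?thesis by (simp add: Edg)
qed simp

lemma linear_dm_diff: "linear dm_diff"
  unfolding dm_diff_def by (rule odd_derivation_linear)

lemma dm_diff_gen_mult: "dm_diff (gen g * x) = dm_diff_gen g * x - gen g * dm_diff x"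
  unfolding dm_diff_def by (rule odd_derivation_gen_mult[OF dm_diff_gen_even])

lemma dm_diff_gens_prod: "dm_diff (gens_prod gs) = der_prod dm_diff_gen gs"
  unfolding dm_diff_def by (rule odd_derivation_gens_prod[OF dm_diff_gen_even])

lemma dm_diff_Vtx: "dm_diff (gen (Vtx i)) = 0"
  and dm_diff_Edg: "dm_diff (gen (Edg i j)) = gen (Vtx i) * gen (Vtx j)"
  unfolding dm_diff_def by (simp_all add: odd_derivation_gen[OF dm_diff_gen_even])

lemma dm_diff_square: "dm_diff (dm_diff x) = 0"
proof -
  have 0: "dm_diff (dm_diff_gen g) = 0" for g :: "'a dm_gen"
    using linear_0[OF linear_dm_diff]
    by (cases g) (simp_all add: dm_diff_gen_mult dm_diff_Vtx)
  have 1: "dm_diff (dm_diff_gen g * x) = dm_diff_gen g * dm_diff x" for g :: "'a dm_gen" and x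
    using linear_0[OF linear_dm_diff]
    by (cases g) (simp_all add: mult.assoc dm_diff_gen_mult)
  show ?thesis
    unfolding dm_diff_def
    by (rule odd_derivation_square[OF dm_diff_gen_even]) (use 0 1 in \<open>simp_all add: dm_diff_def\<close>)
qed

lemma finite_dm_basis:
  assumes "simple_graph G"
  shows "finite (dm_basis G)"
proof -
  have "dm_basis G \<subseteq> Vtx ` verts G \<union> (\<lambda>(i, j). Edg i j) ` (verts G \<times> verts G)"
    using assms by (fastforce simp: dm_basis_def simple_graph_def doubleton_eq_iff)
  then show ?thesis
    by (rule finite_subset) (use assms in \<open>auto simp: simple_graph_def\<close>)
qed

lemma dm_diff_bracket:
  assumes "simple_graph G" "g \<in> dm_basis G"
  shows "dm_diff (gen g) =
    (\<Sum>(a, b) | a \<in> dm_basis G \<and> b \<in> dm_basis G \<and> a < b. dm_bracket G a b g *\<^sub>R (gen a * gen b))"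
proof (cases g)
  case (Vtx i)
  show ?thesis
    unfolding Vtx dm_diff_Vtx
    by (rule sum.neutral[symmetric]) (auto simp: dm_bracket_def split: dm_gen.splits)
next
  case (Edg i j)
  let ?P = "{(a, b). a \<in> dm_basis G \<and> b \<in> dm_basis G \<and> a < b}"
  have ij: "{i, j} \<in> edges G" "i < j" "i \<in> verts G" "j \<in> verts G"
    using assms Edg by (auto simp: dm_basis_def simple_graph_def doubleton_eq_iff)
  have fin: "finite ?P"
    by (rule finite_subset[of _ "dm_basis G \<times> dm_basis G"])
      (use finite_dm_basis[OF assms(1)] in auto)
  have mem: "(Vtx i, Vtx j) \<in> ?P"
    using ij by (auto simp: dm_basis_def less_dm_gen_def less_eq_dm_gen_def)
  have "(\<Sum>(a, b)\<in>?P. dm_bracket G a b g *\<^sub>R (gen a * gen b)) =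
      (\<Sum>(a, b)\<in>{(Vtx i, Vtx j)}. dm_bracket G a b g *\<^sub>R (gen a * gen b))"
    by (rule sum.mono_neutral_right[OF fin])
      (use mem in \<open>auto simp: Edg dm_bracket_def less_dm_gen_def less_eq_dm_gen_def split: dm_gen.splits if_splits\<close>)
  also have "\<dots> = dm_diff (gen g)" using ij by (simp add: Edg dm_bracket_def dm_diff_Edg)
  finally show ?thesis by simp
qed

lemma cochains_eq_Union: "cochains G k = span (\<Union>S. {gens_prod gs | gs.
    set gs \<subseteq> dm_basis G \<and> length gs = k \<and> (\<Union>g\<in>set gs. gen_verts g) = S})"
  unfolding cochains_def by (rule arg_cong[of _ _ span]) auto

lemma der_prod_cochains_on:
  assumes G: "simple_graph G"
  shows "set gs \<subseteq> dm_basis G \<Longrightarrow>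
    der_prod dm_diff_gen gs \<in> cochains_on G (\<Union>g\<in>set gs. gen_verts g) (Suc (length gs))"
proof (induction gs)
  case Nil
  then show ?case by (simp add: cochains_on_def span_0)
next
  case (Cons g gs)
  let ?M = "\<lambda>gs. {gens_prod hs | hs. set hs \<subseteq> dm_basis G \<and> length hs = Suc (length gs) \<and>
    (\<Union>h\<in>set hs. gen_verts h) = (\<Union>h\<in>set gs. gen_verts h)}"
  have 1: "dm_diff_gen g * gens_prod gs \<in> span (?M (g # gs))"
  proof (cases g)
    case (Vtx i)
    then show ?thesis by (simp add: span_0)
  next
    case (Edg i j)
    then have "{i, j} \<in> edges G" using Cons.prems by (auto simp: dm_basis_def)
    then have "i \<in> verts G" "j \<in> verts G"
      using G by (auto simp: simple_graph_def doubleton_eq_iff)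
    then have "set (Vtx i # Vtx j # gs) \<subseteq> dm_basis G"
      using Cons.prems by (auto simp: dm_basis_def)
    then have "gens_prod (Vtx i # Vtx j # gs) \<in> ?M (g # gs)"
      unfolding Edg mem_Collect_eq by (intro exI[of _ "Vtx i # Vtx j # gs"]) auto
    then have "gens_prod (Vtx i # Vtx j # gs) \<in> span (?M (g # gs))" by (rule span_base)
    then show ?thesis by (simp add: Edg mult.assoc)
  qed
  have "linear (\<lambda>x. gen g * x)"
    by (rule linearI) (simp_all add: algebra_simps)
  then have "(\<lambda>x. gen g * x) ` span (?M gs) = span ((\<lambda>x. gen g * x) ` ?M gs)"
    by (rule linear_span_image[symmetric])
  moreover have "der_prod dm_diff_gen gs \<in> span (?M gs)"
    using Cons unfolding cochains_on_def by simp
  ultimately have "gen g * der_prod dm_diff_gen gs \<in> span ((\<lambda>x. gen g * x) ` ?M gs)" by blast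
  moreover have "(\<lambda>x. gen g * x) ` ?M gs \<subseteq> ?M (g # gs)"
  proof (rule image_subsetI)
    fix x assume "x \<in> ?M gs"
    then obtain hs where hs: "x = gens_prod hs" "set hs \<subseteq> dm_basis G" "length hs = Suc (length gs)"
      "(\<Union>h\<in>set hs. gen_verts h) = (\<Union>h\<in>set gs. gen_verts h)" by blast
    show "gen g * x \<in> ?M (g # gs)"
      unfolding mem_Collect_eq by (rule exI[of _ "g # hs"]) (use hs Cons.prems in simp)
  qed
  ultimately have 2: "gen g * der_prod dm_diff_gen gs \<in> span (?M (g # gs))"
    by (rule rev_subsetD[OF _ span_mono])
  have "dm_diff_gen g * gens_prod gs - gen g * der_prod dm_diff_gen gs \<in> span (?M (g # gs))"
    using 1 2 by (rule span_diff)
  then show ?case unfolding cochains_on_def der_prod.simps length_Cons .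
qed

lemma dm_diff_cochains_on:
  assumes "simple_graph G"
  shows "dm_diff ` cochains_on G S k \<subseteq> cochains_on G S (Suc k)"
proof -
  have "dm_diff ` cochains_on G S k = span (dm_diff ` {gens_prod gs | gs.
      set gs \<subseteq> dm_basis G \<and> length gs = k \<and> (\<Union>g\<in>set gs. gen_verts g) = S})"
    unfolding cochains_on_def by (rule linear_span_image[OF linear_dm_diff, symmetric])
  also have "\<dots> \<subseteq> cochains_on G S (Suc k)"
  proof (rule span_minimal)
    show "subspace (cochains_on G S (Suc k))" unfolding cochains_on_def by (rule subspace_span)
  qed (use der_prod_cochains_on[OF assms] in \<open>auto simp: dm_diff_gens_prod\<close>)
  finally show ?thesis .
qed

lemma cochains_on_subset: "cochains_on G S k \<subseteq> cochains G k"
  unfolding cochains_on_def cochains_def by (rule span_mono) auto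

lemma dm_diff_cochains:
  assumes "simple_graph G"
  shows "dm_diff ` cochains G k \<subseteq> cochains G (Suc k)"
proof -
  have "dm_diff ` cochains G k = span (dm_diff ` {gens_prod gs | gs.
      set gs \<subseteq> dm_basis G \<and> length gs = k})"
    unfolding cochains_def by (rule linear_span_image[OF linear_dm_diff, symmetric])
  also have "\<dots> \<subseteq> cochains G (Suc k)"
  proof (rule span_minimal)
    show "subspace (cochains G (Suc k))" unfolding cochains_def by (rule subspace_span)
    show "dm_diff ` {gens_prod gs | gs. set gs \<subseteq> dm_basis G \<and> length gs = k} \<subseteq> cochains G (Suc k)"
      using subsetD[OF cochains_on_subset der_prod_cochains_on[OF assms]]
      by (auto simp: dm_diff_gens_prod)
  qed
  finally show ?thesis .
qed

lemma betti_eq_dim: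
  assumes "simple_graph G"
  shows "betti k G = dim (cocycles (cochains G) dm_diff k) - dim (coboundaries (cochains G) dm_diff k)"
  unfolding betti_def
proof (rule cohomology_dim_eq[where C = "cochains G", OF linear_dm_diff dm_diff_square _
      dm_diff_cochains[OF assms]])
  show "subspace (cochains G k)" for k unfolding cochains_def by (rule subspace_span)
  have "{gens_prod gs | gs. set gs \<subseteq> dm_basis G \<and> length gs = k} =
      gens_prod ` {gs. set gs \<subseteq> dm_basis G \<and> length gs = k}" by auto
  then show "finite {gens_prod gs | gs. set gs \<subseteq> dm_basis G \<and> length gs = k}"
    using finite_lists_length_eq[OF finite_dm_basis[OF assms]] by simp
qed (simp add: cochains_def)

lemma essential_betti_eq_dim:
  assumes "simple_graph H"
  shows "essential_betti k H = dim (cocycles (cochains_on H (verts H)) dm_diff k)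
    - dim (coboundaries (cochains_on H (verts H)) dm_diff k)"
  unfolding essential_betti_def
proof (rule cohomology_dim_eq[where C = "cochains_on H (verts H)",
      OF linear_dm_diff dm_diff_square _ dm_diff_cochains_on[OF assms]])
  show "subspace (cochains_on H (verts H) k)" for k
    unfolding cochains_on_def by (rule subspace_span)
  have "{gens_prod gs | gs. set gs \<subseteq> dm_basis H \<and> length gs = k} =
      gens_prod ` {gs. set gs \<subseteq> dm_basis H \<and> length gs = k}" by auto
  then show "finite {gens_prod gs | gs. set gs \<subseteq> dm_basis H \<and> length gs = k}"
    using finite_lists_length_eq[OF finite_dm_basis[OF assms]] by simp
  show "cochains_on H (verts H) k \<subseteq> span {gens_prod gs | gs. set gs \<subseteq> dm_basis H \<and> length gs = k}"
    using cochains_on_subset[of H "verts H" k] by (simp add: cochains_def)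
qed


section \<open>The list of graphs\<close>

definition edge_graph :: "nat \<Rightarrow> (nat \<times> nat) list \<Rightarrow> nat graph" where
  "edge_graph n es = \<lparr>verts = {1..n}, edges = {{u, v} | u v. (u, v) \<in> set es}\<rparr>"

definition listed_graphs :: "nat graph list" where
  "listed_graphs = (let A = 1; B = 2; C = 3; D = 4; E = 5;
      C5 = [(D, E), (E, A), (A, B), (B, C), (C, D)] in
    [edge_graph 2 [(1, 2)],
     edge_graph 3 [],
     edge_graph 3 [(1, 2)],
     edge_graph 3 [(1, 2), (2, 3)],
     edge_graph 3 [(1, 2), (2, 3), (1, 3)],
     edge_graph 4 [(1, 2), (2, 3)],
     edge_graph 4 [(1, 2), (2, 3), (3, 4)],
     edge_graph 4 [(1, 2), (2, 3), (3, 4), (4, 1)],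
     edge_graph 4 [(1, 2), (2, 3), (1, 3)],
     edge_graph 4 [(1, 2), (1, 3), (1, 4)],
     edge_graph 4 [(1, 2), (2, 3), (1, 3), (3, 4)],
     edge_graph 4 [(1, 2), (1, 3), (1, 4), (2, 3), (2, 4)],
     edge_graph 4 [(1, 2), (1, 3), (1, 4), (2, 3), (2, 4), (3, 4)],
     edge_graph 5 [(D, E), (E, A), (A, B), (B, C), (C, E), (D, B)],
     edge_graph 5 [(D, E), (E, A), (A, B), (B, C), (C, E), (D, B), (E, B)],
     edge_graph 5 C5,
     edge_graph 5 (C5 @ [(C, E)]),
     edge_graph 5 (C5 @ [(C, E), (E, B)]),
     edge_graph 5 (C5 @ [(C, E), (B, D)]),
     edge_graph 5 (C5 @ [(C, E), (E, B), (B, D)]),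
     edge_graph 5 (C5 @ [(C, E), (E, B), (D, A)]),
     edge_graph 5 (C5 @ [(C, E), (E, B), (D, A), (B, D)]),
     edge_graph 5 [(1, 2), (1, 3), (1, 4), (1, 5), (2, 3), (2, 4), (2, 5), (3, 4), (3, 5), (4, 5)]])"

definition listed_graph :: "nat \<Rightarrow> nat graph" where
  "listed_graph j = listed_graphs ! (j - 1)"

lemma simple_edge_graph:
  assumes "\<forall>(u, v)\<in>set es. u \<noteq> v \<and> u \<in> {1..n} \<and> v \<in> {1..n}"
  shows "simple_graph (edge_graph n es)"
  using assms unfolding simple_graph_def edge_graph_def by fastforce

lemma length_listed_graphs: "length listed_graphs = 23"
  by (simp add: listed_graphs_def Let_def)

lemma simple_listed_graph:
  assumes "j \<in> {1..23}"
  shows "simple_graph (listed_graph j)"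
proof -
  have "\<forall>H\<in>set listed_graphs. simple_graph H"
    by (simp add: listed_graphs_def Let_def simple_edge_graph)
  moreover have "listed_graph j \<in> set listed_graphs"
    unfolding listed_graph_def using assms by (intro nth_mem) (auto simp: length_listed_graphs)
  ultimately show ?thesis by blast
qed

end

theory Submission
  imports Defs
begin

text \<open>
  The differential preserves the set of vertices occurring in a monomial, so the complex of \<open>G\<close>
  is the direct sum of the complexes \<open>C(G, S) = C(G[S], S)\<close>, and \<open>b\<^sub>3(G)\<close> is the sum of \<open>\<beta>\<^sub>3(G[S])\<close>
  over all \<open>S\<close>. Relabelling the vertices shows that \<open>\<beta>\<^sub>3\<close> only depends on the isomorphism type,
  so it remains to see that \<open>\<beta>\<^sub>3(H) = 0\<close> unless \<open>H\<close> is one of the \<open>G\<^sub>j\<close>.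

  This uses only which coefficients vanish, not the signs: in a cocycle no boundary term of a
  monomial can come from that monomial alone. A monomial in edges only has a boundary term with
  just two vertices, which determines it; hence every monomial of a 3-cocycle contains a vertex and
  \<open>H\<close> has at most five vertices. With five vertices the monomials are \<open>v \<cdot> e \<cdot> f\<close> for disjoint edges
  \<open>e\<close>, \<open>f\<close>, and following non-zero coefficients yields a walk without backtracking in the Petersen
  graph, hence a 5-cycle or a 6-cycle there; these are the 5-cycles and the subgraphs \<open>K\<^sub>2\<^sub>,\<^sub>3\<close> of \<open>H\<close>.
  With four vertices the only unlisted graphs are the matchings, and there the cocycles are the
  multiples of \<open>d(e f)\<close>.
\<close>

section \<open>Cochains in terms of coefficients\<close>

lemma wsign_nonzero: "wsign A B \<noteq> 0"
  by (simp add: wsign_def)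

lemma coeff_gen_mult:
  "coeff (gen g * x) B = (if g \<in> B then wsign {g} (B - {g}) * coeff x (B - {g}) else 0)"
proof (cases "finite B")
  case True
  have "coeff (gen g * x) B =
      (\<Sum>A\<in>Pow B. if A = {g} then wsign {g} (B - {g}) * coeff x (B - {g}) else 0)"
    unfolding times_ext.rep_eq by (rule sum.cong) (auto simp: gen_def coeff_mono_ext)
  then show ?thesis using True by (simp add: sum.delta)
qed (simp add: coeff_infinite)

text \<open>Sorting the factors only changes the sign, and a repeated factor kills the product, so
  at most one monomial survives.\<close>

lemma coeff_gens_prod:
  "coeff (gens_prod gs) A \<noteq> 0 \<Longrightarrow> A = set gs \<and> distinct gs"
proof (induction gs arbitrary: A)
  case Nil
  then show ?case by (simp add: one_ext.rep_eq split: if_splits)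
next
  case (Cons g gs)
  then have "g \<in> A" "coeff (gens_prod gs) (A - {g}) \<noteq> 0"
    by (auto simp: coeff_gen_mult split: if_splits)
  with Cons.IH[of "A - {g}"] show ?case by auto
qed

text \<open>Spans of monomials are coordinate subspaces. The predicate \<open>Q\<close> sees only
  the set of factors, so one proof serves both \<open>cochains\<close> and
  \<open>cochains_on\<close>, and membership can be tested coefficient by coefficient.\<close>

lemma span_gens_prod_eq:
  "span {gens_prod gs | gs. Q (set gs) \<and> length gs = k} =
    {x. \<forall>A. coeff x A \<noteq> 0 \<longrightarrow> Q A \<and> card A = k}" (is "span ?M = ?C")
proof
  have "subspace ?C"
    by (rule subspaceI) (auto, (metis add_0)+)
  moreover have "?M \<subseteq> ?C"
    by (auto dest: coeff_gens_prod simp: distinct_card)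
  ultimately show "span ?M \<subseteq> ?C" by (intro span_minimal)
  show "?C \<subseteq> span ?M"
  proof
    fix x assume x: "x \<in> ?C"
    have "mono_ext A \<in> ?M" if "coeff x A \<noteq> 0" for A
    proof -
      have fin: "finite A" using that coeff_infinite by blast
      have "Q A" "card A = k" using x that by auto
      with fin have "mono_ext A = gens_prod (sorted_list_of_set A) \<and>
          Q (set (sorted_list_of_set A)) \<and> length (sorted_list_of_set A) = k"
        by (auto simp: mono_ext_gens_prod)
      then show ?thesis by blast
    qed
    then have "(\<Sum>A | coeff x A \<noteq> 0. coeff x A *\<^sub>R mono_ext A) \<in> span ?M"
      by (intro span_sum span_scale span_base) auto
    then show "x \<in> span ?M" by (simp flip: ext_expand)
  qed
qed

lemma cochains_eq: "cochains G k = {x. \<forall>A. coeff x A \<noteq> 0 \<longrightarrow> A \<subseteq> dm_basis G \<and> card A = k}"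
  unfolding cochains_def by (rule span_gens_prod_eq)

lemma cochains_on_eq: "cochains_on G S k =
    {x. \<forall>A. coeff x A \<noteq> 0 \<longrightarrow> A \<subseteq> dm_basis G \<and> (\<Union>g\<in>A. gen_verts g) = S \<and> card A = k}"
  using span_gens_prod_eq[of "\<lambda>A. A \<subseteq> dm_basis G \<and> (\<Union>g\<in>A. gen_verts g) = S" k]
  unfolding cochains_on_def by (simp add: conj_ac)

text \<open>A generator occurring in a monomial with vertex set \<open>S\<close> has its endpoints
  in \<open>S\<close>, so it is already a generator of the induced subgraph. Hence the summand of
  \<open>G\<close> at \<open>S\<close> is the essential complex of
  \<open>induced G S\<close>.\<close>

lemma cochains_on_induced:
  assumes S: "S \<subseteq> verts G"
  shows "cochains_on (induced G S) S k = cochains_on G S k"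
proof -
  have "A \<subseteq> dm_basis (induced G S) \<longleftrightarrow> A \<subseteq> dm_basis G" if "(\<Union>g\<in>A. gen_verts g) = S" for A
  proof -
    have "g \<in> dm_basis (induced G S) \<longleftrightarrow> g \<in> dm_basis G" if "g \<in> A" for g
    proof -
      have "gen_verts g \<subseteq> S" using \<open>g \<in> A\<close> \<open>(\<Union>g\<in>A. gen_verts g) = S\<close> by blast
      then show ?thesis
        using S by (cases g) (auto simp: dm_basis_def induced_def)
    qed
    then show ?thesis by blast
  qed
  then show ?thesis unfolding cochains_on_eq by (intro Collect_cong all_cong1) metis
qed

lemma simple_induced: "simple_graph G \<Longrightarrow> S \<subseteq> verts G \<Longrightarrow> simple_graph (induced G S)"
  unfolding simple_graph_def induced_def by (auto intro: finite_subset) (metis insert_subset)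

section \<open>Decomposition by vertex sets\<close>

text \<open>For the predicate that fixes the vertex set of a monomial, this is the projection onto
  the corresponding summand.\<close>

lift_definition restrict_ext :: "('g set \<Rightarrow> bool) \<Rightarrow> 'g ext \<Rightarrow> 'g ext" is
  "\<lambda>P f A. if P A then f A else 0"
  by (auto intro: rev_finite_subset)

lemma coeff_restrict_ext [simp]: "coeff (restrict_ext P x) A = (if P A then coeff x A else 0)"
  by (simp add: restrict_ext.rep_eq)

lemma linear_restrict_ext: "linear (restrict_ext P)"
  by (rule linearI) (auto intro!: ext_eqI)

text \<open>The labels give the summands disjoint sets of monomials, so \<open>restrict_ext\<close>
  projects onto each of them and the union of their bases stays independent.\<close>

lemma dim_direct_sum:
  fixes V :: "'s \<Rightarrow> 'g ext set" and label :: "'g set \<Rightarrow> 's"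
  assumes I: "finite I" and V: "\<And>s. s \<in> I \<Longrightarrow> subspace (V s)"
    and fin: "\<And>s. s \<in> I \<Longrightarrow> finite W \<and> V s \<subseteq> span W"
    and label: "\<And>s x A. s \<in> I \<Longrightarrow> x \<in> V s \<Longrightarrow> coeff x A \<noteq> 0 \<Longrightarrow> label A = s"
  shows "dim (span (\<Union>s\<in>I. V s)) = (\<Sum>s\<in>I. dim (V s))"
proof -
  have "\<exists>B. B \<subseteq> V s \<and> independent B \<and> V s \<subseteq> span B \<and> card B = dim (V s)" for s
    using basis_exists[of "V s"] by metis
  then obtain B where B: "\<And>s. B s \<subseteq> V s" "\<And>s. independent (B s)" "\<And>s. V s \<subseteq> span (B s)"
    "\<And>s. card (B s) = dim (V s)" by metis
  have finB: "finite (B s)" if "s \<in> I" for s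
    using independent_span_bound[of W "B s"] fin[OF that] B(1,2)[of s] by blast
  have restr: "restrict_ext (\<lambda>A. label A = s) x = (if s = t then x else 0)"
    if "t \<in> I" "x \<in> V t" for s t x
  proof (rule ext_eqI)
    show "coeff (restrict_ext (\<lambda>A. label A = s) x) A = coeff (if s = t then x else 0) A" for A
      using label[OF that, of A] by (cases "coeff x A = 0") auto
  qed
  \<comment> \<open>A common basis vector is both fixed and annihilated by the projection to label
    \<open>s\<close>, hence zero, which no independent set contains.\<close>
  have disj: "B s \<inter> B t = {}" if "s \<in> I" "t \<in> I" "s \<noteq> t" for s t
  proof (rule ccontr)
    assume "B s \<inter> B t \<noteq> {}"
    then obtain x where x: "x \<in> B s" "x \<in> B t" by auto
    then have "x \<noteq> 0" using B(2)[of t] dependent_zero by blast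
    moreover have "x = 0"
      using restr[OF that(1), of x s] restr[OF that(2), of x s] that x B(1)[of s] B(1)[of t] by (metis subsetD)
    ultimately show False by simp
  qed
  have ind: "independent (\<Union>s\<in>I. B s)"
    unfolding independent_explicit_module
  proof (intro allI impI)
    fix F c v
    assume F: "finite F" "F \<subseteq> (\<Union>s\<in>I. B s)" "(\<Sum>v\<in>F. c v *\<^sub>R v) = 0" "v \<in> F"
    obtain s where s: "s \<in> I" "v \<in> B s" using F by auto
    interpret linear "restrict_ext (\<lambda>A. label A = s)" by (rule linear_restrict_ext)
    \<comment> \<open>Projecting the relation to the label of \<open>v\<close> leaves a relation
      within the single basis \<open>B s\<close>.\<close>
    have "0 = restrict_ext (\<lambda>A. label A = s) (\<Sum>v\<in>F. c v *\<^sub>R v)" by (simp add: F(3) zero)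
    also have "\<dots> = (\<Sum>v\<in>F. c v *\<^sub>R restrict_ext (\<lambda>A. label A = s) v)" by (simp add: sum scale)
    also have "\<dots> = (\<Sum>v\<in>F. if v \<in> B s then c v *\<^sub>R v else 0)"
    proof (rule sum.cong)
      fix x assume "x \<in> F"
      then obtain t where t: "t \<in> I" "x \<in> B t" using F(2) by auto
      show "c x *\<^sub>R restrict_ext (\<lambda>A. label A = s) x = (if x \<in> B s then c x *\<^sub>R x else 0)"
        using restr[OF t(1), of x s] t B(1)[of t] disj[OF t(1) s(1)] by (cases "s = t") auto
    qed simp
    also have "\<dots> = (\<Sum>v\<in>F \<inter> B s. c v *\<^sub>R v)" by (simp add: sum.inter_restrict F(1))
    finally have "(\<Sum>v\<in>F \<inter> B s. c v *\<^sub>R v) = 0" by simp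
    then show "c v = 0"
      using B(2)[of s] F(1,4) s(2) unfolding independent_explicit_module
      by (metis Int_iff Int_lower2 finite_Int)
  qed
  have "(\<Union>s\<in>I. V s) \<subseteq> span (\<Union>s\<in>I. B s)"
    using B(3) span_mono[of "B _" "\<Union>s\<in>I. B s"] by blast
  moreover have "(\<Union>s\<in>I. B s) \<subseteq> (\<Union>s\<in>I. V s)"
    using B(1) by blast
  ultimately have "span (\<Union>s\<in>I. V s) = span (\<Union>s\<in>I. B s)"
    by (meson span_minimal span_mono subspace_span subset_antisym)
  then have "dim (span (\<Union>s\<in>I. V s)) = card (\<Union>s\<in>I. B s)"
    by (simp only: real_vector.dim_span_eq_card_independent[OF ind])
  also have "\<dots> = (\<Sum>s\<in>I. card (B s))"
    using I finB disj by (intro card_UN_disjoint) auto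
  finally show ?thesis using B(4) by simp
qed

lemma label_cochains_on:
  "x \<in> cochains_on G S k \<Longrightarrow> coeff x A \<noteq> 0 \<Longrightarrow> (\<Union>g\<in>A. gen_verts g) = S"
  by (simp add: cochains_on_eq)

lemma subspace_cochains_on: "subspace (cochains_on G S k)"
  unfolding cochains_on_def by (rule subspace_span)

lemma subspace_cocycles_on: "subspace (cocycles (cochains_on G S) dm_diff k)"
proof -
  have "cocycles (cochains_on G S) dm_diff k = cochains_on G S k \<inter> {z. dm_diff z = 0}"
    by (auto simp: cocycles_def)
  then show ?thesis
    by (simp add: subspace_inter subspace_cochains_on linear_subspace_kernel[OF linear_dm_diff])
qed

lemma subspace_coboundaries_on: "subspace (coboundaries (cochains_on G S) dm_diff k)"
  by (auto simp: coboundaries_def subspace_cochains_on linear_subspace_image[OF linear_dm_diff]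
      subspace_single_0 split: nat.split)

lemma coboundaries_on_subset_cocycles:
  assumes "simple_graph G"
  shows "coboundaries (cochains_on G S) dm_diff k \<subseteq> cocycles (cochains_on G S) dm_diff k"
  using dm_diff_cochains_on[OF assms] dm_diff_square linear_0[OF linear_dm_diff]
    subspace_0[OF subspace_cochains_on]
  by (auto simp: coboundaries_def cocycles_def split: nat.splits)

lemma finite_spanning_cochains:
  assumes "simple_graph G"
  obtains W where "finite W" "cochains G k \<subseteq> span W"
proof
  have "{gens_prod gs | gs. set gs \<subseteq> dm_basis G \<and> length gs = k} =
      gens_prod ` {gs. set gs \<subseteq> dm_basis G \<and> length gs = k}" by auto
  then show "finite {gens_prod gs | gs. set gs \<subseteq> dm_basis G \<and> length gs = k}"
    using finite_lists_length_eq[OF finite_dm_basis[OF assms]] by simp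
qed (simp add: cochains_def)

text \<open>The additive form avoids truncated subtraction in \<open>nat\<close>, so it can be
  summed over all vertex sets.\<close>

lemma cohomology_dim_cochains_on:
  assumes "simple_graph G"
  shows "cohomology_dim (cochains_on G S) dm_diff k + dim (coboundaries (cochains_on G S) dm_diff k)
    = dim (cocycles (cochains_on G S) dm_diff k)"
proof -
  obtain W where W: "finite W" "cochains G k \<subseteq> span W"
    using finite_spanning_cochains[OF assms] .
  let ?Z = "cocycles (cochains_on G S) dm_diff k" and ?B = "coboundaries (cochains_on G S) dm_diff k"
  have "?Z \<subseteq> span W"
    using W(2) cochains_on_subset[of G S k] by (auto simp: cocycles_def)
  moreover have "quotient_basis ?Z ?B (SOME D. quotient_basis ?Z ?B D)"
    using quotient_basis_exists[OF subspace_cocycles_on subspace_coboundaries_on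
        coboundaries_on_subset_cocycles[OF assms]] by (rule someI_ex)
  ultimately show ?thesis
    unfolding cohomology_dim_def quotient_dim_def
    using quotient_basis_card[OF subspace_cocycles_on subspace_coboundaries_on
        coboundaries_on_subset_cocycles[OF assms] W(1)] by blast
qed

lemma gen_verts_subset: "simple_graph G \<Longrightarrow> g \<in> dm_basis G \<Longrightarrow> gen_verts g \<subseteq> verts G"
  by (cases g) (fastforce simp: dm_basis_def simple_graph_def doubleton_eq_iff)+

lemma restrict_ext_cochains:
  "x \<in> cochains G k \<Longrightarrow> restrict_ext (\<lambda>A. (\<Union>g\<in>A. gen_verts g) = S) x \<in> cochains_on G S k"
  by (simp add: cochains_eq cochains_on_eq)

lemma cochains_eq_sum_restrict:
  assumes G: "simple_graph G" and x: "x \<in> cochains G k"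
  shows "x = (\<Sum>S\<in>Pow (verts G). restrict_ext (\<lambda>A. (\<Union>g\<in>A. gen_verts g) = S) x)"
proof (rule ext_eqI)
  fix A
  have fin: "finite (Pow (verts G))" using G by (simp add: simple_graph_def)
  have "(\<Union>g\<in>A. gen_verts g) \<in> Pow (verts G)" if "coeff x A \<noteq> 0"
  proof -
    have "A \<subseteq> dm_basis G" using that x by (simp add: cochains_eq)
    then show ?thesis using gen_verts_subset[OF G] by blast
  qed
  then show "coeff x A = coeff (\<Sum>S\<in>Pow (verts G). restrict_ext (\<lambda>A. (\<Union>g\<in>A. gen_verts g) = S) x) A"
    using fin by (cases "coeff x A = 0") simp_all
qed

text \<open>The images of the components of a cocycle lie in different summands. As they add up to
  zero, each of them is zero, so each component is itself a cocycle.\<close>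

lemma cocycles_decomposition:
  assumes G: "simple_graph G"
  shows "cocycles (cochains G) dm_diff k =
    span (\<Union>S\<in>Pow (verts G). cocycles (cochains_on G S) dm_diff k)" (is "?Z = span ?U")
proof
  interpret linear dm_diff by (rule linear_dm_diff)
  let ?r = "\<lambda>S. restrict_ext (\<lambda>A. (\<Union>g\<in>A. gen_verts g) = S)"
  have fin: "finite (Pow (verts G))" using G by (simp add: simple_graph_def)
  have "?Z = cochains G k \<inter> {z. dm_diff z = 0}" by (auto simp: cocycles_def)
  moreover have "subspace (cochains G k)" unfolding cochains_def by (rule subspace_span)
  ultimately have "subspace ?Z"
    by (simp add: subspace_inter linear_subspace_kernel[OF linear_dm_diff])
  moreover have "?U \<subseteq> ?Z"
    using cochains_on_subset by (fastforce simp: cocycles_def)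
  ultimately show "span ?U \<subseteq> ?Z" by (intro span_minimal)
  show "?Z \<subseteq> span ?U"
  proof
    fix z assume "z \<in> ?Z"
    then have z: "z \<in> cochains G k" "dm_diff z = 0" by (auto simp: cocycles_def)
    have rz: "?r S z \<in> cochains_on G S k" for S by (rule restrict_ext_cochains[OF z(1)])
    have drz: "dm_diff (?r S z) \<in> cochains_on G S (Suc k)" for S
      using rz dm_diff_cochains_on[OF G] by blast
    have "dm_diff (?r S z) = 0" if S: "S \<in> Pow (verts G)" for S
    proof (rule ext_eqI)
      fix A
      have "(\<Sum>T\<in>Pow (verts G). dm_diff (?r T z)) = 0"
        using cochains_eq_sum_restrict[OF G z(1)] z(2) by (metis sum)
      then have "0 = (\<Sum>T\<in>Pow (verts G). coeff (dm_diff (?r T z)) A)"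
        by (metis coeff_simps(1) coeff_sum)
      \<comment> \<open>The monomial \<open>A\<close> has just one vertex set, so a single summand
        can contribute to its coefficient.\<close>
      also have "\<dots> = (\<Sum>T\<in>Pow (verts G). if T = (\<Union>g\<in>A. gen_verts g) then coeff (dm_diff (?r T z)) A else 0)"
      proof (rule sum.cong[OF refl])
        fix T
        show "coeff (dm_diff (?r T z)) A =
            (if T = (\<Union>g\<in>A. gen_verts g) then coeff (dm_diff (?r T z)) A else 0)"
          using label_cochains_on[OF drz, of T A] by (cases "coeff (dm_diff (?r T z)) A = 0") auto
      qed
      finally have 0: "0 = (if (\<Union>g\<in>A. gen_verts g) \<in> Pow (verts G)
          then coeff (dm_diff (?r (\<Union>g\<in>A. gen_verts g) z)) A else 0)"
        using fin by (simp add: sum.delta')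
      show "coeff (dm_diff (?r S z)) A = coeff 0 A"
      proof (rule ccontr)
        assume *: "coeff (dm_diff (?r S z)) A \<noteq> coeff 0 A"
        then have "(\<Union>g\<in>A. gen_verts g) = S" using label_cochains_on[OF drz, of S A] by simp
        then show False using 0 S * by (metis coeff_simps(1))
      qed
    qed
    then have "?r S z \<in> span ?U" if "S \<in> Pow (verts G)" for S
      using rz that by (intro span_base) (auto simp: cocycles_def)
    then show "z \<in> span ?U"
      by (subst cochains_eq_sum_restrict[OF G z(1)]) (rule span_sum)
  qed
qed

lemma coboundaries_decomposition:
  assumes G: "simple_graph G"
  shows "coboundaries (cochains G) dm_diff k =
    span (\<Union>S\<in>Pow (verts G). coboundaries (cochains_on G S) dm_diff k)"
proof (cases k)
  case 0
  have "(\<Union>S\<in>Pow (verts G). {0 :: 'a dm_gen ext}) = {0}" by auto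
  then show ?thesis using 0 by (simp add: coboundaries_def)
next
  case (Suc j)
  interpret linear dm_diff by (rule linear_dm_diff)
  let ?r = "\<lambda>S. restrict_ext (\<lambda>A. (\<Union>g\<in>A. gen_verts g) = S)"
  let ?U = "\<Union>S\<in>Pow (verts G). dm_diff ` cochains_on G S j"
  have "dm_diff ` cochains G j = span ?U"
  proof
    have "subspace (cochains G j)" unfolding cochains_def by (rule subspace_span)
    then have "subspace (dm_diff ` cochains G j)" by (rule linear_subspace_image[OF linear_dm_diff])
    moreover have "?U \<subseteq> dm_diff ` cochains G j" using cochains_on_subset by blast
    ultimately show "span ?U \<subseteq> dm_diff ` cochains G j" by (intro span_minimal)
    show "dm_diff ` cochains G j \<subseteq> span ?U"
    proof (rule image_subsetI)
      fix x assume x: "x \<in> cochains G j"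
      have "dm_diff x = (\<Sum>S\<in>Pow (verts G). dm_diff (?r S x))"
        by (subst cochains_eq_sum_restrict[OF G x]) (rule sum)
      moreover have "dm_diff (?r S x) \<in> span ?U" if "S \<in> Pow (verts G)" for S
        using that restrict_ext_cochains[OF x, of S] by (intro span_base) blast
      ultimately show "dm_diff x \<in> span ?U" by (metis (no_types, lifting) span_sum)
    qed
  qed
  then show ?thesis using Suc by (simp add: coboundaries_def)
qed

theorem betti_eq_sum_essential_betti:
  assumes G: "simple_graph G"
  shows "betti k G = (\<Sum>S\<in>Pow (verts G). essential_betti k (induced G S))"
proof -
  let ?Z = "\<lambda>S. cocycles (cochains_on G S) dm_diff k"
  let ?B = "\<lambda>S. coboundaries (cochains_on G S) dm_diff k"
  obtain W where W: "finite W" "cochains G k \<subseteq> span W"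
    using finite_spanning_cochains[OF G] .
  have fin: "finite (Pow (verts G))" using G by (simp add: simple_graph_def)
  have ZC: "?Z S \<subseteq> cochains_on G S k" for S by (auto simp: cocycles_def)
  have ZW: "finite W \<and> ?Z S \<subseteq> span W" for S
    using W cochains_on_subset[of G S k] ZC[of S] by blast
  have BZ: "?B S \<subseteq> ?Z S" for S by (rule coboundaries_on_subset_cocycles[OF G])
  have eb: "essential_betti k (induced G S) = cohomology_dim (cochains_on G S) dm_diff k"
    if "S \<in> Pow (verts G)" for S
  proof -
    have "cochains_on (induced G S) S = cochains_on G S"
      using cochains_on_induced[of S G] that by blast
    then show ?thesis by (simp add: essential_betti_def induced_def)
  qed
  have label: "(\<Union>g\<in>A. gen_verts g) = S" if "x \<in> ?Z S" "coeff x A \<noteq> 0" for x A S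
    using label_cochains_on[of x G S k A] that ZC[of S] by blast
  have "dim (cocycles (cochains G) dm_diff k) = (\<Sum>S\<in>Pow (verts G). dim (?Z S))"
    unfolding cocycles_decomposition[OF G]
    by (rule dim_direct_sum[where label = "\<lambda>A. \<Union>g\<in>A. gen_verts g",
          OF fin subspace_cocycles_on ZW label])
  moreover have "dim (coboundaries (cochains G) dm_diff k) = (\<Sum>S\<in>Pow (verts G). dim (?B S))"
    unfolding coboundaries_decomposition[OF G]
  proof (rule dim_direct_sum[where label = "\<lambda>A. \<Union>g\<in>A. gen_verts g", OF fin subspace_coboundaries_on])
    show "finite W \<and> ?B S \<subseteq> span W" for S using ZW BZ by blast
    show "(\<Union>g\<in>A. gen_verts g) = S" if "x \<in> ?B S" "coeff x A \<noteq> 0" for x A S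
      using label[of x S A] that BZ[of S] by blast
  qed
  moreover have "(\<Sum>S\<in>Pow (verts G). dim (?Z S)) =
      (\<Sum>S\<in>Pow (verts G). essential_betti k (induced G S)) + (\<Sum>S\<in>Pow (verts G). dim (?B S))"
    unfolding sum.distrib[symmetric]
    by (rule sum.cong) (simp_all add: eb cohomology_dim_cochains_on[OF G])
  ultimately show ?thesis by (simp add: betti_eq_dim[OF G])
qed

section \<open>Algebra homomorphisms and isomorphism invariance\<close>

text \<open>The algebra homomorphism given by the universal property of the exterior algebra,
  evaluated on sorted monomials. It is multiplicative when the values of \<open>\<phi>\<close>
  anticommute, which the context below assumes.\<close>

definition ext_hom :: "('g::linorder \<Rightarrow> 'h::linorder ext) \<Rightarrow> 'g ext \<Rightarrow> 'h ext" where
  "ext_hom \<phi> x = (\<Sum>A | coeff x A \<noteq> 0. coeff x A *\<^sub>R prod_list (map \<phi> (sorted_list_of_set A)))"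

lemma linear_ext_hom: "linear (ext_hom \<phi>)"
proof (rule linearI)
  have superset: "ext_hom \<phi> x = (\<Sum>A\<in>S. coeff x A *\<^sub>R prod_list (map \<phi> (sorted_list_of_set A)))"
    if "finite S" "{A. coeff x A \<noteq> 0} \<subseteq> S" for x S
    unfolding ext_hom_def by (rule sum.mono_neutral_left) (use that in auto)
  fix x y :: "'a ext" and c :: real
  let ?S = "{A. coeff x A \<noteq> 0} \<union> {A. coeff y A \<noteq> 0}"
  have S: "finite ?S" by (simp add: finite_coeff)
  show "ext_hom \<phi> (x + y) = ext_hom \<phi> x + ext_hom \<phi> y"
    by (subst (1 2 3) superset[OF S]) (auto simp: scaleR_add_left sum.distrib)
  show "ext_hom \<phi> (c *\<^sub>R x) = c *\<^sub>R ext_hom \<phi> x"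
    by (subst (1 2) superset[OF finite_coeff[of x]]) (auto simp: scaleR_sum_right)
qed

lemma ext_hom_mono: "finite A \<Longrightarrow> ext_hom \<phi> (mono_ext A) = prod_list (map \<phi> (sorted_list_of_set A))"
proof -
  assume A: "finite A"
  then have "{B. coeff (mono_ext A) B \<noteq> 0} = {A}" by (auto simp: coeff_mono_ext)
  then show ?thesis using A by (simp add: ext_hom_def coeff_mono_ext)
qed

lemma ext_linear_eqI:
  assumes "linear f" "linear g" "\<And>gs. f (gens_prod gs) = g (gens_prod gs)"
  shows "f x = g x"
  using linear_eq_on_span[OF assms(1,2), of "range gens_prod"] assms(3) ext_span_gens_prod by blast

context
  fixes \<phi> :: "'g::linorder \<Rightarrow> 'h::linorder ext"
  assumes anticommute: "\<And>g h. \<phi> g * \<phi> h = - (\<phi> h * \<phi> g)"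
begin

lemma hom_swap: "\<phi> g * (\<phi> h * x) = - (\<phi> h * (\<phi> g * x))"
  using anticommute[of g h] by (simp flip: mult.assoc)

text \<open>Anticommuting a factor with itself gives \<open>y = - y\<close>, and 2 is invertible
  over the reals.\<close>

lemma hom_square: "\<phi> g * (\<phi> g * x) = 0"
proof -
  have "2 *\<^sub>R (\<phi> g * (\<phi> g * x)) = \<phi> g * (\<phi> g * x) + - (\<phi> g * (\<phi> g * x))"
    unfolding scaleR_2 using hom_swap[of g g x] by (rule arg_cong)
  then show ?thesis by simp
qed

text \<open>Moving \<open>g\<close> into its place costs the same sign in the source and in the
  image. The scalar is left unspecified, since what matters is that both sides share it.\<close>

lemma hom_insort:
  "\<exists>c. gens_prod (g # gs) = c *\<^sub>R gens_prod (insort g gs) \<and>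
       prod_list (map \<phi> (g # gs)) = c *\<^sub>R prod_list (map \<phi> (insort g gs))"
proof (induction gs)
  case (Cons h gs)
  then obtain c where c: "gen g * gens_prod gs = c *\<^sub>R gens_prod (insort g gs)"
    "\<phi> g * prod_list (map \<phi> gs) = c *\<^sub>R prod_list (map \<phi> (insort g gs))" by auto
  show ?case
  proof (cases "g \<le> h")
    case False
    have "gen g * (gen h * gens_prod gs) = - (gen h * (gen g * gens_prod gs))"
      using gen_anticommute[of g h] by (simp flip: mult.assoc)
    then show ?thesis
      using False hom_swap[of g h "prod_list (map \<phi> gs)"] by (intro exI[of _ "- c"]) (simp add: c)
  qed (intro exI[of _ 1], simp)
qed (intro exI[of _ 1], simp)

lemma hom_repeat: "g \<in> set gs \<Longrightarrow> \<phi> g * prod_list (map \<phi> gs) = 0"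
proof (induction gs)
  case (Cons h gs)
  then show ?case
    using hom_swap[of g h "prod_list (map \<phi> gs)"] hom_square[of g]
    by (cases "g = h") simp_all
qed simp

text \<open>On a monomial, a repeated generator makes both sides zero; otherwise both sides are
  sorted at the cost of the same scalar. Linearity extends this to all \<open>x\<close>.\<close>

lemma ext_hom_gen_mult: "ext_hom \<phi> (gen g * x) = \<phi> g * ext_hom \<phi> x"
proof -
  interpret linear "ext_hom \<phi>" by (rule linear_ext_hom)
  have mono: "ext_hom \<phi> (gen g * mono_ext A) = \<phi> g * ext_hom \<phi> (mono_ext A)" if A: "finite A" for A
  proof (cases "g \<in> A")
    case True
    then have "gen g * mono_ext A = 0" using A by (simp add: gen_def mono_ext_mult)
    then show ?thesis using True A hom_repeat[of g "sorted_list_of_set A"]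
      by (simp add: zero ext_hom_mono)
  next
    case False
    obtain c where c: "gens_prod (g # sorted_list_of_set A) = c *\<^sub>R gens_prod (insort g (sorted_list_of_set A))"
      "prod_list (map \<phi> (g # sorted_list_of_set A)) = c *\<^sub>R prod_list (map \<phi> (insort g (sorted_list_of_set A)))"
      using hom_insort by blast
    have ins: "insort g (sorted_list_of_set A) = sorted_list_of_set (insert g A)"
      using False A by simp
    have "gen g * mono_ext A = c *\<^sub>R mono_ext (insert g A)"
      using c(1) A unfolding ins by (simp add: mono_ext_gens_prod)
    then show ?thesis using c(2) A unfolding ins by (simp add: scale ext_hom_mono)
  qed
  have "linear (\<lambda>x. ext_hom \<phi> (gen g * x))" "linear (\<lambda>x. \<phi> g * ext_hom \<phi> x)"
    by (rule linearI; simp add: algebra_simps add scale)+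
  then show ?thesis
    using linear_eq_on_span[of "\<lambda>x. ext_hom \<phi> (gen g * x)" "\<lambda>x. \<phi> g * ext_hom \<phi> x" "mono_ext ` Collect finite" x]
      mono ext_span_mono by auto
qed

lemma ext_hom_gens_prod: "ext_hom \<phi> (gens_prod gs) = prod_list (map \<phi> gs)"
  by (induction gs) (simp_all add: ext_hom_gen_mult ext_hom_mono flip: mono_ext_empty)

end

section \<open>The cochain map induced by a map of vertices\<close>

fun relabel_gen :: "('v \<Rightarrow> 'w::linorder) \<Rightarrow> 'v dm_gen \<Rightarrow> 'w dm_gen" where
  "relabel_gen f (Vtx i) = Vtx (f i)"
| "relabel_gen f (Edg i j) = (if f i < f j then Edg (f i) (f j) else Edg (f j) (f i))"

text \<open>When \<open>f\<close> reverses the endpoints of an edge, sorting the product of the two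
  vertex generators changes its sign, so the edge generator has to change sign as well for the map
  to commute with the differential.\<close>

fun relabel_sign :: "('v \<Rightarrow> 'w::linorder) \<Rightarrow> 'v dm_gen \<Rightarrow> real" where
  "relabel_sign f (Vtx i) = 1"
| "relabel_sign f (Edg i j) = (if f i < f j then 1 else -1)"

definition relabel :: "('v::linorder \<Rightarrow> 'w::linorder) \<Rightarrow> 'v dm_gen ext \<Rightarrow> 'w dm_gen ext" where
  "relabel f = ext_hom (\<lambda>g. relabel_sign f g *\<^sub>R gen (relabel_gen f g))"

lemma relabel_anticommute:
  "(relabel_sign f g *\<^sub>R gen (relabel_gen f g)) * (relabel_sign f h *\<^sub>R gen (relabel_gen f h)) =
    - ((relabel_sign f h *\<^sub>R gen (relabel_gen f h)) * (relabel_sign f g *\<^sub>R gen (relabel_gen f g)))"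
  using gen_anticommute[of "relabel_gen f g" "relabel_gen f h"] by (simp add: mult.commute)

lemma linear_relabel: "linear (relabel f)"
  unfolding relabel_def by (rule linear_ext_hom)

lemma relabel_gen_mult:
  "relabel f (gen g * x) = relabel_sign f g *\<^sub>R (gen (relabel_gen f g) * relabel f x)"
  unfolding relabel_def by (subst ext_hom_gen_mult[OF relabel_anticommute]) simp

lemma relabel_one: "relabel f 1 = 1"
  unfolding relabel_def using ext_hom_gens_prod[OF relabel_anticommute, where gs = "[]"] by simp

lemma relabel_gens_prod:
  "\<exists>c. relabel f (gens_prod gs) = c *\<^sub>R gens_prod (map (relabel_gen f) gs)"
proof (induction gs)
  case (Cons g gs)
  then obtain c where "relabel f (gens_prod gs) = c *\<^sub>R gens_prod (map (relabel_gen f) gs)" by blast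
  then show ?case by (intro exI[of _ "relabel_sign f g * c"]) (simp add: relabel_gen_mult)
qed (simp add: relabel_one exI[of _ 1])

lemma relabel_dm_diff_gen_mult:
  "relabel f (dm_diff_gen g * x) = relabel_sign f g *\<^sub>R (dm_diff_gen (relabel_gen f g) * relabel f x)"
proof (cases g)
  case (Vtx i)
  then show ?thesis by (simp add: linear_0[OF linear_relabel])
next
  case (Edg i j)
  show ?thesis
    using gen_anticommute[of "Vtx (f i)" "Vtx (f j)"]
    by (simp add: Edg mult.assoc relabel_gen_mult) (simp flip: mult.assoc)
qed

text \<open>Both sides obey the same Leibniz recursion on products of generators, and these products
  span.\<close>

lemma dm_diff_relabel:
  fixes f :: "'v::linorder \<Rightarrow> 'w::linorder"
  shows "dm_diff (relabel f x) = relabel f (dm_diff x)"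
proof (rule ext_linear_eqI[of "\<lambda>x. dm_diff (relabel f x)" "\<lambda>x. relabel f (dm_diff x)"])
  interpret d: linear "dm_diff :: 'v dm_gen ext \<Rightarrow> 'v dm_gen ext" by (rule linear_dm_diff)
  interpret d': linear "dm_diff :: 'w dm_gen ext \<Rightarrow> 'w dm_gen ext" by (rule linear_dm_diff)
  interpret r: linear "relabel f" by (rule linear_relabel)
  show "linear (\<lambda>x. dm_diff (relabel f x))" "linear (\<lambda>x. relabel f (dm_diff x))"
    by (rule linearI; simp add: d.add d.scale d'.add d'.scale r.add r.scale)+
  show "dm_diff (relabel f (gens_prod gs)) = relabel f (dm_diff (gens_prod gs))" for gs
  proof (induction gs)
    case Nil
    have "dm_diff (1 :: 'v dm_gen ext) = 0" "dm_diff (1 :: 'w dm_gen ext) = 0"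
      using dm_diff_gens_prod[of "[]"] by simp_all
    then show ?case by (simp add: relabel_one r.zero)
  next
    case (Cons g gs)
    then show ?case
      by (simp add: relabel_gen_mult d'.scale dm_diff_gen_mult r.diff relabel_dm_diff_gen_mult
          scaleR_diff_right)
  qed
qed

lemma relabel_cochains_on:
  assumes G: "simple_graph G" and f: "bij_betw f (verts G) (verts H)"
    and fe: "\<And>u v. u \<in> verts G \<Longrightarrow> v \<in> verts G \<Longrightarrow> {u, v} \<in> edges G \<longleftrightarrow> {f u, f v} \<in> edges H"
  shows "relabel f ` cochains_on G (verts G) k \<subseteq> cochains_on H (verts H) k"
proof -
  let ?M = "\<lambda>G. {gens_prod gs | gs. set gs \<subseteq> dm_basis G \<and> length gs = k \<and>
      (\<Union>g\<in>set gs. gen_verts g) = verts G}"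
  have gv: "gen_verts (relabel_gen f g) = f ` gen_verts g" for g
    by (cases g) auto
  have gb: "relabel_gen f g \<in> dm_basis H" if g: "g \<in> dm_basis G" for g
  proof (cases g)
    case (Vtx i)
    then show ?thesis using g f by (auto simp: dm_basis_def bij_betw_def)
  next
    case (Edg i j)
    have ij: "{i, j} \<in> edges G" "i < j" using g Edg by (auto simp: dm_basis_def)
    moreover have "i \<in> verts G" "j \<in> verts G" using gen_verts_subset[OF G g] Edg by auto
    ultimately have "{f i, f j} \<in> edges H" "f i \<noteq> f j"
      using fe f by (auto simp: bij_betw_def inj_on_def)
    then show ?thesis by (auto simp: Edg dm_basis_def insert_commute)
  qed
  have "relabel f (gens_prod gs) \<in> span (?M H)"
    if gs: "set gs \<subseteq> dm_basis G" "length gs = k" "(\<Union>g\<in>set gs. gen_verts g) = verts G" for gs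
  proof -
    have "(\<Union>g\<in>set (map (relabel_gen f) gs). gen_verts g) = f ` (\<Union>g\<in>set gs. gen_verts g)"
      by (auto simp: gv)
    also have "\<dots> = verts H" using gs(3) f by (simp add: bij_betw_def)
    finally have "(\<Union>g\<in>set (map (relabel_gen f) gs). gen_verts g) = verts H" .
    moreover have "set (map (relabel_gen f) gs) \<subseteq> dm_basis H" using gs(1) gb by auto
    ultimately have "gens_prod (map (relabel_gen f) gs) \<in> ?M H"
      using gs(2) length_map by blast
    then have *: "c *\<^sub>R gens_prod (map (relabel_gen f) gs) \<in> span (?M H)" for c
      by (intro span_scale span_base)
    obtain c where "relabel f (gens_prod gs) = c *\<^sub>R gens_prod (map (relabel_gen f) gs)"
      using relabel_gens_prod[of f gs] by blast
    then show ?thesis using *[of c] by (simp only:)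
  qed
  then have "relabel f ` ?M G \<subseteq> span (?M H)" by blast
  then have "span (relabel f ` ?M G) \<subseteq> span (?M H)"
    by (rule span_minimal) (rule subspace_span)
  then show ?thesis
    unfolding cochains_on_def linear_span_image[OF linear_relabel] .
qed

text \<open>For an edge whose order \<open>f\<close> reverses, \<open>f'\<close> reverses it back,
  so the two signs cancel and the composite fixes every generator of \<open>G\<close>.\<close>

lemma relabel_inverse:
  assumes "\<And>v. v \<in> verts G \<Longrightarrow> f' (f v) = v" "simple_graph G" "x \<in> cochains_on G S k"
  shows "relabel f' (relabel f x) = x"
proof -
  interpret r: linear "relabel f" by (rule linear_relabel)
  interpret r': linear "relabel f'" by (rule linear_relabel)
  have inv: "relabel_gen f' (relabel_gen f g) = g \<and> relabel_sign f' (relabel_gen f g) * relabel_sign f g = 1"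
    if g: "g \<in> dm_basis G" for g
  proof (cases g)
    case (Vtx i)
    then show ?thesis using g assms(1) by (auto simp: dm_basis_def)
  next
    case (Edg i j)
    then have "i < j" "f' (f i) = i" "f' (f j) = j"
      using g assms(1) gen_verts_subset[OF assms(2) g] by (auto simp: dm_basis_def)
    then show ?thesis by (auto simp: Edg)
  qed
  have "relabel f' (relabel f (gens_prod gs)) = gens_prod gs" if "set gs \<subseteq> dm_basis G" for gs
    using that
  proof (induction gs)
    case (Cons g gs)
    then show ?case using inv[of g]
      by (simp add: relabel_gen_mult r'.scale mult.commute)
  qed (simp add: relabel_one)
  moreover have "linear (\<lambda>x. relabel f' (relabel f x))"
    by (rule linearI) (simp_all add: r.add r.scale r'.add r'.scale)
  ultimately show ?thesis
    using linear_eq_on_span[of "\<lambda>x. relabel f' (relabel f x)" "\<lambda>x. x"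
        "{gens_prod gs | gs. set gs \<subseteq> dm_basis G \<and> length gs = k \<and> (\<Union>g\<in>set gs. gen_verts g) = S}" x]
      assms(3) by (auto simp: cochains_on_def linear_iff)
qed

lemma dim_inj_image:
  assumes "linear f" "subspace V" "inj_on f V"
  shows "dim (f ` V) = dim V"
proof -
  obtain B where B: "B \<subseteq> V" "independent B" "V \<subseteq> span B" "card B = dim V"
    by (rule basis_exists)
  have V: "span B = V" using B(1,3) assms(2) by (simp add: span_subspace)
  have "f ` V = span (f ` B)" by (simp add: linear_span_image[OF assms(1)] V)
  moreover have "independent (f ` B)"
    using linear_independent_injective_image[OF assms(1) B(2)] assms(3) V by simp
  ultimately have "dim (f ` V) = card (f ` B)" using real_vector.dim_span_eq_card_independent by metis
  then show ?thesis using B(1,4) assms(3) by (simp add: card_image inj_on_subset)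
qed

text \<open>An isomorphism and its inverse induce mutually inverse cochain maps, which match
  cocycles with cocycles and coboundaries with coboundaries.\<close>

lemma essential_betti_iso:
  assumes G: "simple_graph G" and H: "simple_graph H" and iso: "graph_iso G H"
  shows "essential_betti k G = essential_betti k H"
proof -
  obtain f where f: "bij_betw f (verts G) (verts H)"
    "\<And>u v. u \<in> verts G \<Longrightarrow> v \<in> verts G \<Longrightarrow> {u, v} \<in> edges G \<longleftrightarrow> {f u, f v} \<in> edges H"
    using iso unfolding graph_iso_def by blast
  define f' where "f' = inv_into (verts G) f"
  have f': "bij_betw f' (verts H) (verts G)" unfolding f'_def by (rule bij_betw_inv_into[OF f(1)])
  have f'f: "f' (f v) = v" if "v \<in> verts G" for v
    using bij_betw_inv_into_left[OF f(1) that] by (simp add: f'_def)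
  have ff': "f (f' v) = v" if "v \<in> verts H" for v
    using bij_betw_inv_into_right[OF f(1) that] by (simp add: f'_def)
  have f'e: "{u, v} \<in> edges H \<longleftrightarrow> {f' u, f' v} \<in> edges G" if "u \<in> verts H" "v \<in> verts H" for u v
    using f(2)[of "f' u" "f' v"] ff' that f' by (auto simp: bij_betw_def)
  let ?C = "\<lambda>k. cochains_on G (verts G) k" and ?D = "\<lambda>k. cochains_on H (verts H) k"
  have CD: "relabel f ` ?C k \<subseteq> ?D k" for k by (rule relabel_cochains_on[OF G f(1) f(2)])
  have DC: "relabel f' ` ?D k \<subseteq> ?C k" for k by (rule relabel_cochains_on[OF H f' f'e])
  have inv: "relabel f' (relabel f x) = x" if "x \<in> ?C k" for x k
    using relabel_inverse[of G f' f x] f'f G that by blast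
  have inv': "relabel f (relabel f' x) = x" if "x \<in> ?D k" for x k
    using relabel_inverse[of H f f' x] ff' H that by blast
  have inj: "inj_on (relabel f) (?C k)" for k by (rule inj_onI) (metis inv)
  have image: "relabel f ` ?C k = ?D k" for k
    using CD[of k] DC[of k] inv' by force
  have Z: "relabel f ` cocycles ?C dm_diff k = cocycles ?D dm_diff k"
  proof
    show "relabel f ` cocycles ?C dm_diff k \<subseteq> cocycles ?D dm_diff k"
      using CD[of k] linear_0[OF linear_relabel] by (auto simp: cocycles_def dm_diff_relabel)
    show "cocycles ?D dm_diff k \<subseteq> relabel f ` cocycles ?C dm_diff k"
    proof
      fix z assume z: "z \<in> cocycles ?D dm_diff k"
      then have "relabel f' z \<in> cocycles ?C dm_diff k"
        using DC[of k] linear_0[OF linear_relabel] by (auto simp: cocycles_def dm_diff_relabel)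
      moreover have "z = relabel f (relabel f' z)" by (rule inv'[symmetric]) (use z in \<open>auto simp: cocycles_def\<close>)
      ultimately show "z \<in> relabel f ` cocycles ?C dm_diff k" by blast
    qed
  qed
  have B: "relabel f ` coboundaries ?C dm_diff k = coboundaries ?D dm_diff k"
  proof (cases k)
    case (Suc j)
    have "relabel f ` dm_diff ` ?C j = dm_diff ` relabel f ` ?C j"
      by (simp add: image_image dm_diff_relabel)
    then show ?thesis using image by (simp add: coboundaries_def Suc)
  qed (simp add: coboundaries_def linear_0[OF linear_relabel])
  have ZC: "cocycles ?C dm_diff k \<subseteq> ?C k" by (auto simp: cocycles_def)
  have BC: "coboundaries ?C dm_diff k \<subseteq> ?C k"
    using coboundaries_on_subset_cocycles[OF G] ZC by blast
  have "dim (cocycles ?D dm_diff k) = dim (cocycles ?C dm_diff k)"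
    unfolding Z[symmetric]
    by (rule dim_inj_image[OF linear_relabel subspace_cocycles_on inj_on_subset[OF inj ZC]])
  moreover have "dim (coboundaries ?D dm_diff k) = dim (coboundaries ?C dm_diff k)"
    unfolding B[symmetric]
    by (rule dim_inj_image[OF linear_relabel subspace_coboundaries_on inj_on_subset[OF inj BC]])
  ultimately show ?thesis
    using essential_betti_eq_dim[OF G, of k] essential_betti_eq_dim[OF H, of k] by simp
qed

section \<open>The support of the differential\<close>

text \<open>\<open>B\<close> runs through the boundary terms of the monomial \<open>A\<close>: one
  edge factor is replaced by its two endpoints, which must not occur in \<open>A\<close> already
  because repeated factors give zero.\<close>

definition diff_support :: "'v dm_gen set \<Rightarrow> 'v dm_gen set \<Rightarrow> bool" where
  "diff_support A B \<longleftrightarrow> (\<exists>i j. i \<noteq> j \<and> Edg i j \<in> A \<and> Vtx i \<notin> A \<and> Vtx j \<notin> A \<and>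
    B = {Vtx i, Vtx j} \<union> (A - {Edg i j}))"

lemma diff_support_insert_Vtx:
  assumes "Vtx v \<notin> A"
  shows "diff_support (insert (Vtx v) A) B \<longleftrightarrow> Vtx v \<in> B \<and> diff_support A (B - {Vtx v})"
proof
  assume "diff_support (insert (Vtx v) A) B"
  then obtain i j where ij: "i \<noteq> j" "Edg i j \<in> A" "Vtx i \<notin> A" "Vtx j \<notin> A" "i \<noteq> v" "j \<noteq> v"
    and B: "B = {Vtx i, Vtx j} \<union> (insert (Vtx v) A - {Edg i j})"
    unfolding diff_support_def by auto
  have "Vtx v \<in> B" "B - {Vtx v} = {Vtx i, Vtx j} \<union> (A - {Edg i j})"
    unfolding B using assms ij by auto
  then show "Vtx v \<in> B \<and> diff_support A (B - {Vtx v})"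
    unfolding diff_support_def using ij by blast
next
  assume *: "Vtx v \<in> B \<and> diff_support A (B - {Vtx v})"
  then obtain i j where ij: "i \<noteq> j" "Edg i j \<in> A" "Vtx i \<notin> A" "Vtx j \<notin> A"
    and B: "B - {Vtx v} = {Vtx i, Vtx j} \<union> (A - {Edg i j})"
    unfolding diff_support_def by blast
  have v: "i \<noteq> v" "j \<noteq> v" using B by blast+
  have "B = {Vtx i, Vtx j} \<union> (insert (Vtx v) A - {Edg i j})" using B * by blast
  then show "diff_support (insert (Vtx v) A) B"
    unfolding diff_support_def using ij v by blast
qed

text \<open>The two alternatives mirror the two terms of the Leibniz rule: the new factor is
  expanded, or it survives and an older one is expanded.\<close>

lemma diff_support_insert_Edg:
  assumes "Edg i j \<notin> A"
  shows "diff_support (insert (Edg i j) A) B \<longleftrightarrow>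
    (i \<noteq> j \<and> Vtx i \<notin> A \<and> Vtx j \<notin> A \<and> B = {Vtx i, Vtx j} \<union> A) \<or>
    (Edg i j \<in> B \<and> diff_support A (B - {Edg i j}))"  (is "?l \<longleftrightarrow> ?a \<or> ?b")
proof
  assume ?l
  then obtain k l where kl: "k \<noteq> l" "Edg k l \<in> insert (Edg i j) A" "Vtx k \<notin> A" "Vtx l \<notin> A"
    "B = {Vtx k, Vtx l} \<union> (insert (Edg i j) A - {Edg k l})"
    unfolding diff_support_def by blast
  show "?a \<or> ?b"
  proof (cases "Edg k l = Edg i j")
    case True
    then show ?thesis using kl assms by simp
  next
    case False
    then have "Edg i j \<in> B" "B - {Edg i j} = {Vtx k, Vtx l} \<union> (A - {Edg k l})" "Edg k l \<in> A"
      using kl assms by blast+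
    then show ?thesis unfolding diff_support_def using kl by blast
  qed
next
  assume "?a \<or> ?b"
  then show ?l
  proof
    assume a: ?a
    then have "B = {Vtx i, Vtx j} \<union> (insert (Edg i j) A - {Edg i j})" using assms by blast
    then show ?l unfolding diff_support_def using a by blast
  next
    assume b: ?b
    then obtain k l where kl: "k \<noteq> l" "Edg k l \<in> A" "Vtx k \<notin> A" "Vtx l \<notin> A"
      and B: "B - {Edg i j} = {Vtx k, Vtx l} \<union> (A - {Edg k l})"
      unfolding diff_support_def by blast
    have "B = {Vtx k, Vtx l} \<union> (insert (Edg i j) A - {Edg k l})" using B b kl assms by blast
    then show ?l unfolding diff_support_def using kl by blast
  qed
qed

text \<open>Expanding different edge factors yields different monomials, so nothing cancels inside
  the differential of a single monomial.\<close>

lemma coeff_dm_diff_mono_ext: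
  fixes A :: "'v::linorder dm_gen set"
  assumes "finite A"
  shows "coeff (dm_diff (mono_ext A)) B \<noteq> 0 \<longleftrightarrow> diff_support A B"
  using assms
proof (induction A arbitrary: B)
  case empty
  show ?case
    using dm_diff_gens_prod[of "[] :: 'v dm_gen list"] by (simp add: mono_ext_empty diff_support_def)
next
  case (insert g A)
  interpret linear dm_diff by (rule linear_dm_diff)
  have "gen g * mono_ext A = wsign {g} A *\<^sub>R mono_ext (insert g A)"
    using insert by (simp add: gen_def mono_ext_mult)
  then have "coeff (dm_diff (mono_ext (insert g A))) B \<noteq> 0 \<longleftrightarrow>
      coeff (dm_diff (gen g * mono_ext A)) B \<noteq> 0"
    by (simp add: scale wsign_nonzero)
  also have "dm_diff (gen g * mono_ext A) = dm_diff_gen g * mono_ext A - gen g * dm_diff (mono_ext A)"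
    by (rule dm_diff_gen_mult)
  also have "coeff \<dots> B \<noteq> 0 \<longleftrightarrow> diff_support (insert g A) B"
  proof (cases g)
    case (Vtx v)
    then show ?thesis using insert
      by (simp add: coeff_gen_mult wsign_nonzero diff_support_insert_Vtx)
  next
    case (Edg i j)
    have B: "coeff (gen (Vtx i) * gen (Vtx j) * mono_ext A) B \<noteq> 0 \<longleftrightarrow>
        i \<noteq> j \<and> Vtx i \<notin> A \<and> Vtx j \<notin> A \<and> B = {Vtx i, Vtx j} \<union> A"
      using insert(1)
      by (simp add: mult.assoc coeff_gen_mult wsign_nonzero coeff_mono_ext) auto
    have 2: "coeff (gen g * dm_diff (mono_ext A)) B \<noteq> 0 \<longleftrightarrow> g \<in> B \<and> diff_support A (B - {g})"
      using insert.IH by (simp add: coeff_gen_mult wsign_nonzero)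
    \<comment> \<open>The two Leibniz terms have disjoint supports: monomials without
      \<open>g\<close> in the first, monomials with \<open>g\<close> in the second.\<close>
    have "g \<in> B \<Longrightarrow> coeff (gen (Vtx i) * gen (Vtx j) * mono_ext A) B = 0"
      using B insert(2) Edg by auto
    moreover have "g \<notin> B \<Longrightarrow> coeff (gen g * dm_diff (mono_ext A)) B = 0" using 2 by blast
    ultimately have "coeff (dm_diff_gen g * mono_ext A - gen g * dm_diff (mono_ext A)) B \<noteq> 0 \<longleftrightarrow>
        coeff (gen (Vtx i) * gen (Vtx j) * mono_ext A) B \<noteq> 0 \<or>
        coeff (gen g * dm_diff (mono_ext A)) B \<noteq> 0"
      by (cases "g \<in> B") (simp_all add: Edg)
    then show ?thesis
      unfolding B 2 using diff_support_insert_Edg[of i j A B] insert(2) Edg by simp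
  qed
  finally show ?case .
qed

lemma coeff_dm_diff: "coeff (dm_diff x) B = (\<Sum>A | coeff x A \<noteq> 0. coeff x A * coeff (dm_diff (mono_ext A)) B)"
proof -
  interpret linear dm_diff by (rule linear_dm_diff)
  have "dm_diff x = (\<Sum>A | coeff x A \<noteq> 0. coeff x A *\<^sub>R dm_diff (mono_ext A))"
    by (subst (1) ext_expand[of x]) (simp add: sum scale)
  then show ?thesis by simp
qed

lemma cocycle_second_term:
  assumes "dm_diff z = 0" "coeff z A \<noteq> 0" "diff_support A B"
  shows "\<exists>A'. A' \<noteq> A \<and> coeff z A' \<noteq> 0 \<and> diff_support A' B"
proof (rule ccontr)
  assume no: "\<not> ?thesis"
  have A: "finite A" using assms(2) coeff_infinite by blast
  have "0 = (\<Sum>A' | coeff z A' \<noteq> 0. coeff z A' * coeff (dm_diff (mono_ext A')) B)"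
    using coeff_dm_diff[of z B] assms(1) by simp
  \<comment> \<open>Without a second contributor the whole coefficient at \<open>B\<close> comes
    from \<open>A\<close>, whose contribution is nonzero.\<close>
  also have "\<dots> = (\<Sum>A'\<in>{A}. coeff z A' * coeff (dm_diff (mono_ext A')) B)"
  proof (rule sum.mono_neutral_right)
    have "coeff (dm_diff (mono_ext A')) B = 0" if "coeff z A' \<noteq> 0" "A' \<noteq> A" for A'
    proof (rule ccontr)
      assume "coeff (dm_diff (mono_ext A')) B \<noteq> 0"
      moreover have "finite A'" using \<open>coeff z A' \<noteq> 0\<close> coeff_infinite by blast
      ultimately have "diff_support A' B" using coeff_dm_diff_mono_ext by blast
      then show False using no \<open>A' \<noteq> A\<close> \<open>coeff z A' \<noteq> 0\<close> by blast
    qed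
    then show "\<forall>A'\<in>{A. coeff z A \<noteq> 0} - {A}. coeff z A' * coeff (dm_diff (mono_ext A')) B = 0"
      by auto
  qed (use assms(2) finite_coeff[of z] in auto)
  also have "\<dots> = coeff z A * coeff (dm_diff (mono_ext A)) B" by simp
  finally show False using coeff_dm_diff_mono_ext[OF A, of B] assms(2,3) by simp
qed

section \<open>Recognising the listed graphs\<close>

lemma graph_iso_sym: "graph_iso G H \<Longrightarrow> graph_iso H G"
proof -
  assume "graph_iso G H"
  then obtain f where f: "bij_betw f (verts G) (verts H)"
    and fe: "\<And>u v. u \<in> verts G \<Longrightarrow> v \<in> verts G \<Longrightarrow> {u, v} \<in> edges G \<longleftrightarrow> {f u, f v} \<in> edges H"
    unfolding graph_iso_def by blast
  let ?g = "inv_into (verts G) f"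
  have g: "bij_betw ?g (verts H) (verts G)" by (rule bij_betw_inv_into[OF f])
  have "{u, v} \<in> edges H \<longleftrightarrow> {?g u, ?g v} \<in> edges G" if "u \<in> verts H" "v \<in> verts H" for u v
    using fe[of "?g u" "?g v"] bij_betw_apply[OF g] that
      bij_betw_inv_into_right[OF f that(1)] bij_betw_inv_into_right[OF f that(2)] by simp
  then show ?thesis unfolding graph_iso_def using g by blast
qed

text \<open>Any base would give an isomorphism invariant; 4 is the least one that separates all the
  listed graphs.\<close>

definition codegree_sum :: "'v graph \<Rightarrow> nat" where
  "codegree_sum G = (\<Sum>u\<in>verts G. \<Sum>v\<in>verts G.
    4 ^ card {w \<in> verts G. {u, w} \<in> edges G \<and> {v, w} \<in> edges G})"

text \<open>The exponents count common neighbours (degrees on the diagonal), and an isomorphism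
  carries common neighbourhoods to common neighbourhoods.\<close>

lemma codegree_sum_iso:
  assumes "graph_iso G H"
  shows "codegree_sum G = codegree_sum H"
proof -
  obtain f where f: "bij_betw f (verts G) (verts H)"
    and fe: "\<And>u v. u \<in> verts G \<Longrightarrow> v \<in> verts G \<Longrightarrow> {u, v} \<in> edges G \<longleftrightarrow> {f u, f v} \<in> edges H"
    using assms unfolding graph_iso_def by blast
  have "card {w \<in> verts H. {f u, w} \<in> edges H \<and> {f v, w} \<in> edges H} =
      card {w \<in> verts G. {u, w} \<in> edges G \<and> {v, w} \<in> edges G}"
    if "u \<in> verts G" "v \<in> verts G" for u v
  proof -
    have "{w \<in> verts H. {f u, w} \<in> edges H \<and> {f v, w} \<in> edges H} =
        f ` {w \<in> verts G. {u, w} \<in> edges G \<and> {v, w} \<in> edges G}"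
    proof
      show "{w \<in> verts H. {f u, w} \<in> edges H \<and> {f v, w} \<in> edges H} \<subseteq>
          f ` {w \<in> verts G. {u, w} \<in> edges G \<and> {v, w} \<in> edges G}"
      proof
        fix x assume "x \<in> {w \<in> verts H. {f u, w} \<in> edges H \<and> {f v, w} \<in> edges H}"
        moreover from this obtain w where "w \<in> verts G" "x = f w" using f by (auto simp: bij_betw_def)
        ultimately show "x \<in> f ` {w \<in> verts G. {u, w} \<in> edges G \<and> {v, w} \<in> edges G}"
          using fe that by auto
      qed
    qed (use f fe that in \<open>auto simp: bij_betw_def\<close>)
    moreover have "inj_on f {w \<in> verts G. {u, w} \<in> edges G \<and> {v, w} \<in> edges G}"
      using f by (auto intro: inj_on_subset simp: bij_betw_def)
    ultimately show ?thesis by (simp only: card_image)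
  qed
  then have "codegree_sum G = (\<Sum>u\<in>verts G. \<Sum>v\<in>verts G.
      4 ^ card {w \<in> verts H. {f u, w} \<in> edges H \<and> {f v, w} \<in> edges H})"
    unfolding codegree_sum_def by simp
  also have "\<dots> = (\<Sum>u\<in>verts G. \<Sum>v\<in>verts H. 4 ^ card {w \<in> verts H. {f u, w} \<in> edges H \<and> {v, w} \<in> edges H})"
    by (rule sum.cong[OF refl]) (rule sum.reindex_bij_betw[OF f])
  also have "\<dots> = codegree_sum H"
    unfolding codegree_sum_def by (rule sum.reindex_bij_betw[OF f])
  finally show ?thesis .
qed

lemma edges_edge_graph: "{u, v} \<in> edges (edge_graph n es) \<longleftrightarrow> (u, v) \<in> set es \<or> (v, u) \<in> set es"
  by (auto simp: edge_graph_def doubleton_eq_iff)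

lemma verts_edge_graph: "verts (edge_graph n es) = {1..n}"
  by (simp add: edge_graph_def)

text \<open>A form in terms of lists that \<open>simp\<close> can evaluate on concrete
  graphs.\<close>

lemma codegree_sum_edge_graph: "codegree_sum (edge_graph n es) =
  (\<Sum>u\<leftarrow>[1..<Suc n]. \<Sum>v\<leftarrow>[1..<Suc n]. 4 ^ length (filter
    (\<lambda>w. ((u, w) \<in> set es \<or> (w, u) \<in> set es) \<and> ((v, w) \<in> set es \<or> (w, v) \<in> set es)) [1..<Suc n]))"
proof -
  have v: "verts (edge_graph n es) = set [1..<Suc n]" by (auto simp: edge_graph_def)
  have "card {w \<in> set [1..<Suc n]. P w} = length (filter P [1..<Suc n])" for P
    by (metis distinct_card distinct_filter distinct_upt set_filter)
  then show ?thesis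
    unfolding codegree_sum_def v edges_edge_graph
    by (simp only: sum.distinct_set_conv_list[OF distinct_upt])
qed

lemma distinct_codegree_sums: "distinct (map codegree_sum listed_graphs)"
proof -
  have upts: "[1..<Suc 2] = [1, 2]" "[1..<Suc 3] = [1, 2, 3]" "[1..<Suc 4] = [1, 2, 3, 4]"
    "[1..<Suc 5] = [1, 2, 3, 4, 5]"
    by (simp_all add: upt_rec)
  show ?thesis
    unfolding listed_graphs_def Let_def list.map codegree_sum_edge_graph upts by simp
qed

lemma listed_graph_iso_unique:
  assumes "i \<in> {1..23}" "j \<in> {1..23}" "graph_iso H (listed_graph i)" "graph_iso H (listed_graph j)"
  shows "i = j"
proof -
  have "codegree_sum (listed_graph i) = codegree_sum (listed_graph j)"
    using assms(3,4) codegree_sum_iso by metis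
  then show ?thesis
    using nth_eq_iff_index_eq[OF distinct_codegree_sums, of "i - 1" "j - 1"] assms(1,2)
    by (simp add: listed_graph_def length_listed_graphs) linarith
qed

text \<open>Listing the vertices of \<open>H\<close> names the isomorphism. Pairs
  \<open>i < j\<close> suffice because edges are unordered and simple graphs have no loops.\<close>

lemma graph_iso_list:
  fixes K :: "nat graph"
  assumes "simple_graph H" "simple_graph K" "distinct vs" "set vs = verts H" "verts K = {1..n}" "n = length vs"
    and e: "\<forall>j\<in>{1..n}. \<forall>i\<in>{1..<j}.
      {vs ! (i - 1), vs ! (j - 1)} \<in> edges H \<longleftrightarrow> {i, j} \<in> edges K"
  shows "graph_iso H K"
proof (rule graph_iso_sym)
  \<comment> \<open>Vertices of \<open>K\<close> are counted from 1, list positions from 0.\<close>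
  have "bij_betw (\<lambda>i. i - 1) {1..n} {..<n}"
    by (rule bij_betw_byWitness[where f' = Suc]) auto
  moreover have "bij_betw ((!) vs) {..<n} (verts H)"
    using assms(3,4,6) by (intro bij_betw_nth) auto
  ultimately have "bij_betw ((!) vs \<circ> (\<lambda>i. i - 1)) {1..n} (verts H)" by (rule bij_betw_trans)
  then have bij: "bij_betw (\<lambda>i. vs ! (i - 1)) (verts K) (verts H)" by (simp add: comp_def assms(5))
  have loop: "{x} \<notin> edges H" "{y} \<notin> edges K" for x y
    using assms(1,2) by (auto simp: simple_graph_def)
  have "{i, j} \<in> edges K \<longleftrightarrow> {vs ! (i - 1), vs ! (j - 1)} \<in> edges H"
    if "i \<in> verts K" "j \<in> verts K" for i j
  proof (cases i j rule: linorder_cases)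
    case less
    then show ?thesis using e that by (simp add: assms(5))
  next
    case greater
    then have "{vs ! (j - 1), vs ! (i - 1)} \<in> edges H \<longleftrightarrow> {j, i} \<in> edges K"
      using e that by (simp add: assms(5))
    then show ?thesis by (simp add: insert_commute)
  qed (use loop in simp)
  then show "graph_iso K H" unfolding graph_iso_def using bij by blast
qed

section \<open>Adjacency patterns of the listed graphs\<close>

definition listed :: "'v graph \<Rightarrow> bool" where
  "listed H \<longleftrightarrow> (\<exists>j\<in>{1..23}. graph_iso H (listed_graph j))"

text \<open>The tuple records all pairs, so for graphs on three vertices equal tuples mean that
  matching the vertices in order is an isomorphism.\<close>

definition adj3 :: "'v graph \<Rightarrow> 'v \<Rightarrow> 'v \<Rightarrow> 'v \<Rightarrow> bool \<times> bool \<times> bool" where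
  "adj3 H a b c =
    ({a, b} \<in> edges H, {a, c} \<in> edges H, {b, c} \<in> edges H)"

definition adj4 :: "'v graph \<Rightarrow> 'v \<Rightarrow> 'v \<Rightarrow> 'v \<Rightarrow> 'v \<Rightarrow> bool \<times> bool \<times> bool \<times> bool \<times> bool \<times> bool" where
  "adj4 H a b c d =
    ({a, b} \<in> edges H, {a, c} \<in> edges H, {a, d} \<in> edges H, {b, c} \<in> edges H,
     {b, d} \<in> edges H, {c, d} \<in> edges H)"

text \<open>The edges of the cycle \<open>a, b, c, d, e\<close> come first, then those of the pentagram
  \<open>a, c, e, b, d\<close>, so that rotating the arguments rotates both halves.\<close>

definition adj5 :: "'v graph \<Rightarrow> 'v \<Rightarrow> 'v \<Rightarrow> 'v \<Rightarrow> 'v \<Rightarrow> 'v \<Rightarrow> bool \<times> bool \<times> bool \<times> bool \<times> bool \<times> bool \<times> bool \<times> bool \<times> bool \<times> bool" where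
  "adj5 H a b c d e =
    ({a, b} \<in> edges H, {b, c} \<in> edges H, {c, d} \<in> edges H, {d, e} \<in> edges H,
     {e, a} \<in> edges H, {a, c} \<in> edges H, {c, e} \<in> edges H, {e, b} \<in> edges H,
     {b, d} \<in> edges H, {d, a} \<in> edges H)"

lemma verts_listed_graph:
  "verts (listed_graph 1) = {1..2}"
  "j \<in> {2..5} \<Longrightarrow> verts (listed_graph j) = {1..3}"
  "j \<in> {6..13} \<Longrightarrow> verts (listed_graph j) = {1..4}"
  "j \<in> {14..23} \<Longrightarrow> verts (listed_graph j) = {1..5}"
proof -
  have "\<forall>j\<in>set [2..<6]. verts (listed_graph j) = {1..3}"
    "\<forall>j\<in>set [6..<14]. verts (listed_graph j) = {1..4}"
    "\<forall>j\<in>set [14..<24]. verts (listed_graph j) = {1..5}"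
    unfolding listed_graph_def listed_graphs_def Let_def by (simp_all add: verts_edge_graph del: set_upt)
  moreover have "{2..5} = set [2..<6]" "{6..13} = set [6..<14]" "{14..23} = set [14..<24]"
    unfolding set_upt by auto
  ultimately show "j \<in> {2..5} \<Longrightarrow> verts (listed_graph j) = {1..3}"
    "j \<in> {6..13} \<Longrightarrow> verts (listed_graph j) = {1..4}"
    "j \<in> {14..23} \<Longrightarrow> verts (listed_graph j) = {1..5}"
    by blast+
qed (simp add: listed_graph_def listed_graphs_def Let_def verts_edge_graph)

lemma adj3_listed_graphs:
  "(\<lambda>j. adj3 (listed_graph j) 1 2 3) ` {2..5} =
    {(False, False, False),
     (True, False, False),
     (True, False, True),
     (True, True, True)}"
proof -
  \<comment> \<open>Enumerating the interval as a list lets \<open>simp\<close> evaluate the pattern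
    at each index.\<close>
  have "{2..5} = set [2..<6]" unfolding set_upt by auto
  then show ?thesis
    unfolding adj3_def listed_graph_def listed_graphs_def Let_def
    by (simp add: edges_edge_graph del: set_upt)
qed

lemma adj4_listed_graphs:
  "(\<lambda>j. adj4 (listed_graph j) 1 2 3 4) ` {6..13} =
    {(True, False, False, True, False, False),
     (True, False, False, True, False, True),
     (True, False, True, True, False, True),
     (True, True, False, True, False, False),
     (True, True, True, False, False, False),
     (True, True, False, True, False, True),
     (True, True, True, True, True, False),
     (True, True, True, True, True, True)}"
proof -
  have "{6..13} = set [6..<14]" unfolding set_upt by auto
  then show ?thesis
    unfolding adj4_def listed_graph_def listed_graphs_def Let_def
    by (simp add: edges_edge_graph del: set_upt)
qed

lemma adj5_listed_graphs:
  "(\<lambda>j. adj5 (listed_graph j) 1 2 3 4 5) ` {14..23} =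
    {(True, True, False, True, True, False, True, False, True, False),
     (True, True, False, True, True, False, True, True, True, False),
     (True, True, True, True, True, False, False, False, False, False),
     (True, True, True, True, True, False, True, False, False, False),
     (True, True, True, True, True, False, True, True, False, False),
     (True, True, True, True, True, False, True, False, True, False),
     (True, True, True, True, True, False, True, True, True, False),
     (True, True, True, True, True, False, True, True, False, True),
     (True, True, True, True, True, False, True, True, True, True),
     (True, True, True, True, True, True, True, True, True, True)}"
proof -
  have "{14..23} = set [14..<24]" unfolding set_upt by auto
  then show ?thesis
    unfolding adj5_def listed_graph_def listed_graphs_def Let_def
    by (simp add: edges_edge_graph del: set_upt)
qed

lemma listed_if_adj3:
  assumes H: "simple_graph H" "distinct [a, b, c]" "{a, b, c} = verts H"
    and adj: "adj3 H a b c \<in> (\<lambda>j. adj3 (listed_graph j) 1 2 3) ` {2..5}"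
  shows "listed H"
proof -
  obtain j where j: "j \<in> {2..5}" "adj3 H a b c = adj3 (listed_graph j) 1 2 3"
    using adj by blast
  have *: "{1..3} = {1, 2, 3 :: nat}" "{1..<1} = ({} :: nat set)" "{1..<2} = {1 :: nat}" "{1..<3} = {1, 2 :: nat}"
    by auto
  have "graph_iso H (listed_graph j)"
    by (rule graph_iso_list[of _ _ "[a, b, c]" 3])
      (use H j verts_listed_graph simple_listed_graph[of j] in
        \<open>simp_all add: adj3_def insert_commute *[unfolded One_nat_def]\<close>)
  then show ?thesis unfolding listed_def using j by auto
qed

lemma listed_if_adj4:
  assumes H: "simple_graph H" "distinct [a, b, c, d]" "{a, b, c, d} = verts H"
    and adj: "adj4 H a b c d \<in> (\<lambda>j. adj4 (listed_graph j) 1 2 3 4) ` {6..13}"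
  shows "listed H"
proof -
  obtain j where j: "j \<in> {6..13}" "adj4 H a b c d = adj4 (listed_graph j) 1 2 3 4"
    using adj by blast
  have *: "{1..4} = {1, 2, 3, 4 :: nat}" "{1..<1} = ({} :: nat set)" "{1..<2} = {1 :: nat}" "{1..<3} = {1, 2 :: nat}" "{1..<4} = {1, 2, 3 :: nat}"
    by auto
  have "graph_iso H (listed_graph j)"
    by (rule graph_iso_list[of _ _ "[a, b, c, d]" 4])
      (use H j verts_listed_graph simple_listed_graph[of j] in
        \<open>simp_all add: adj4_def insert_commute *[unfolded One_nat_def]\<close>)
  then show ?thesis unfolding listed_def using j by auto
qed

lemma listed_if_adj5:
  assumes H: "simple_graph H" "distinct [a, b, c, d, e]" "{a, b, c, d, e} = verts H"
    and adj: "adj5 H a b c d e \<in> (\<lambda>j. adj5 (listed_graph j) 1 2 3 4 5) ` {14..23}"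
  shows "listed H"
proof -
  obtain j where j: "j \<in> {14..23}" "adj5 H a b c d e = adj5 (listed_graph j) 1 2 3 4 5"
    using adj by blast
  have *: "{1..5} = {1, 2, 3, 4, 5 :: nat}" "{1..<1} = ({} :: nat set)" "{1..<2} = {1 :: nat}" "{1..<3} = {1, 2 :: nat}" "{1..<4} = {1, 2, 3 :: nat}" "{1..<5} = {1, 2, 3, 4 :: nat}"
    by auto
  have "graph_iso H (listed_graph j)"
    by (rule graph_iso_list[of _ _ "[a, b, c, d, e]" 5])
      (use H j verts_listed_graph simple_listed_graph[of j] in
        \<open>simp_all add: adj5_def insert_commute *[unfolded One_nat_def]\<close>)
  then show ?thesis unfolding listed_def using j by auto
qed

lemma listed_2:
  assumes H: "simple_graph H" "distinct [a, b]" "verts H = {a, b}" and "{a, b} \<in> edges H"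
  shows "listed H"
proof -
  have *: "{1..2} = {1, 2 :: nat}" "{1..<1} = ({} :: nat set)" "{1..<2} = {1 :: nat}"
    by auto
  have "{1, 2} \<in> edges (listed_graph 1)"
    by (simp add: listed_graph_def listed_graphs_def Let_def edges_edge_graph)
  then have "graph_iso H (listed_graph 1)"
    by (intro graph_iso_list[of _ _ "[a, b]" 2])
      (use assms verts_listed_graph(1) simple_listed_graph[of 1] in \<open>simp_all add: *[unfolded One_nat_def]\<close>)
  then show ?thesis unfolding listed_def by (intro bexI[of _ 1]) simp_all
qed

text \<open>A graph on three vertices is determined by its number of edges, and all four
  possibilities are in the list.\<close>

lemma listed_3:
  assumes H: "simple_graph H" "distinct [a, b, c]" "{a, b, c} = verts H"
  shows "listed H"
proof -
  note base = listed_if_adj3[OF H(1), unfolded adj3_listed_graphs, unfolded adj3_def]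
  have neq: "a \<noteq> b" "a \<noteq> c" "b \<noteq> c"
    using H(2) by simp_all
  show ?thesis
    \<comment> \<open>These orderings move a single edge to the first pair and the centre of a path
      to the middle.\<close>
    using base[of a b c] base[of a c b] base[of b c a] base[of b a c]
    by (cases "{a, b} \<in> edges H"; cases "{a, c} \<in> edges H"; cases "{b, c} \<in> edges H")
      (simp_all add: insert_commute neq neq[symmetric] flip: H(3))
qed

text \<open>Two edges sharing a vertex exclude the matchings, and the other graphs on four vertices
  are all listed.\<close>

lemma listed_4:
  assumes H: "simple_graph H" "distinct [a, b, c, d]" "{a, b, c, d} = verts H"
    and path: "{a, b} \<in> edges H" "{b, c} \<in> edges H"
  shows "listed H"
proof -
  let ?P = "\<lambda>x y z w. adj4 H x y z w \<in> (\<lambda>j. adj4 (listed_graph j) 1 2 3 4) ` {6..13}"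
  have neq: "a \<noteq> b" "a \<noteq> c" "a \<noteq> d" "b \<noteq> c" "b \<noteq> d" "c \<noteq> d"
    using H(2) by simp_all
  \<comment> \<open>The four undecided pairs leave sixteen patterns; for each of them one of these
    orderings produces a tuple of the table.\<close>
  have "?P a b c d \<or> ?P d a b c \<or> ?P b a c d \<or> ?P b c a d \<or> ?P a c b d \<or> ?P a d b c \<or> ?P c d b a \<or> ?P b d a c"
    unfolding adj4_listed_graphs unfolding adj4_def insert_iff empty_iff prod.inject
    using path by (simp add: insert_commute) argo
  then show ?thesis
  proof (elim disjE)
    show ?thesis if "?P a b c d"
      by (rule listed_if_adj4[OF H(1) _ _ that]) (use neq in \<open>auto simp flip: H(3)\<close>)
    show ?thesis if "?P d a b c"
      by (rule listed_if_adj4[OF H(1) _ _ that]) (use neq in \<open>auto simp flip: H(3)\<close>)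
    show ?thesis if "?P b a c d"
      by (rule listed_if_adj4[OF H(1) _ _ that]) (use neq in \<open>auto simp flip: H(3)\<close>)
    show ?thesis if "?P b c a d"
      by (rule listed_if_adj4[OF H(1) _ _ that]) (use neq in \<open>auto simp flip: H(3)\<close>)
    show ?thesis if "?P a c b d"
      by (rule listed_if_adj4[OF H(1) _ _ that]) (use neq in \<open>auto simp flip: H(3)\<close>)
    show ?thesis if "?P a d b c"
      by (rule listed_if_adj4[OF H(1) _ _ that]) (use neq in \<open>auto simp flip: H(3)\<close>)
    show ?thesis if "?P c d b a"
      by (rule listed_if_adj4[OF H(1) _ _ that]) (use neq in \<open>auto simp flip: H(3)\<close>)
    show ?thesis if "?P b d a c"
      by (rule listed_if_adj4[OF H(1) _ _ that]) (use neq in \<open>auto simp flip: H(3)\<close>)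
  qed
qed

text \<open>The five chords form a binary word read along the pentagram. Up to rotation there are
  eight binary words of length five, one for each of the last eight listed graphs, so the five
  rotations of the cycle suffice.\<close>

lemma listed_hamiltonian:
  assumes H: "simple_graph H" "distinct [a, b, c, d, e]" "{a, b, c, d, e} = verts H"
    and path: "{a, b} \<in> edges H" "{b, c} \<in> edges H" "{c, d} \<in> edges H" "{d, e} \<in> edges H" "{e, a} \<in> edges H"
  shows "listed H"
proof -
  let ?P = "\<lambda>x y z w u. adj5 H x y z w u \<in> (\<lambda>j. adj5 (listed_graph j) 1 2 3 4 5) ` {14..23}"
  have neq: "a \<noteq> b" "a \<noteq> c" "a \<noteq> d" "a \<noteq> e" "b \<noteq> c" "b \<noteq> d" "b \<noteq> e" "c \<noteq> d" "c \<noteq> e" "d \<noteq> e"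
    using H(2) by simp_all
  have "?P a b c d e \<or> ?P b c d e a \<or> ?P c d e a b \<or> ?P d e a b c \<or> ?P e a b c d"
    unfolding adj5_listed_graphs unfolding adj5_def insert_iff empty_iff prod.inject
    using path by (simp add: insert_commute) argo
  then show ?thesis
  proof (elim disjE)
    show ?thesis if "?P a b c d e"
      by (rule listed_if_adj5[OF H(1) _ _ that]) (use neq in \<open>auto simp flip: H(3)\<close>)
    show ?thesis if "?P b c d e a"
      by (rule listed_if_adj5[OF H(1) _ _ that]) (use neq in \<open>auto simp flip: H(3)\<close>)
    show ?thesis if "?P c d e a b"
      by (rule listed_if_adj5[OF H(1) _ _ that]) (use neq in \<open>auto simp flip: H(3)\<close>)
    show ?thesis if "?P d e a b c"
      by (rule listed_if_adj5[OF H(1) _ _ that]) (use neq in \<open>auto simp flip: H(3)\<close>)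
    show ?thesis if "?P e a b c d"
      by (rule listed_if_adj5[OF H(1) _ _ that]) (use neq in \<open>auto simp flip: H(3)\<close>)
  qed
qed

text \<open>An edge inside the part of size three creates a Hamiltonian cycle. Otherwise just the
  pair \<open>{a, c}\<close> is undecided, which gives K23 or K113.\<close>

lemma listed_K23:
  assumes H: "simple_graph H" "distinct [a, c, x, y, z]" "{a, c, x, y, z} = verts H"
    and e: "\<forall>p\<in>{a, c}. \<forall>q\<in>{x, y, z}. {p, q} \<in> edges H"
  shows "listed H"
proof (cases "{x, y} \<in> edges H \<or> {x, z} \<in> edges H \<or> {y, z} \<in> edges H")
  case True
  \<comment> \<open>The cycle is \<open>a, p, q, c, r\<close>: it uses the extra edge once and
    passes through \<open>a\<close> and \<open>c\<close> otherwise.\<close>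
  have "listed H" if "{p, q} \<in> edges H" "distinct [p, q, r]" "{p, q, r} = {x, y, z}" for p q r
  proof (rule listed_hamiltonian[of H a p q c r])
    have "{a, p, q, c, r} = {a, c} \<union> {p, q, r}" by auto
    also have "\<dots> = {a, c} \<union> {x, y, z}" by (simp only: that(3))
    also have "\<dots> = verts H" unfolding H(3)[symmetric] by auto
    finally show "{a, p, q, c, r} = verts H" .
    have mem: "p \<in> {x, y, z}" "q \<in> {x, y, z}" "r \<in> {x, y, z}"
      unfolding that(3)[symmetric] by simp_all
    then show "distinct [a, p, q, c, r]" using that(2) H(2) by auto
    show "{a, p} \<in> edges H" "{c, r} \<in> edges H" using e mem by blast+
    show "{q, c} \<in> edges H" "{r, a} \<in> edges H"
      using e mem by (subst insert_commute, blast)+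
  qed (use H(1) that(1) in auto)
  from this[of x y z] this[of x z y] this[of y z x] show ?thesis
    using True H(2) by (auto simp only: insert_commute distinct.simps list.set simp_thms insert_iff empty_iff)
next
  case False
  \<comment> \<open>In the listed K23 and K113 the part of size two is \<open>{B, E}\<close>, so
    \<open>a\<close> and \<open>c\<close> go to positions 2 and 5.\<close>
  have "distinct [x, a, y, z, c]" "{x, a, y, z, c} = verts H" using H(2,3) by auto
  note base = listed_if_adj5[OF H(1) this, unfolded adj5_listed_graphs, unfolded adj5_def]
  show ?thesis
    by (rule base) (use False e in \<open>cases "{a, c} \<in> edges H"; simp add: insert_commute\<close>)
qed

section \<open>Vanishing for all other graphs\<close>

text \<open>Hides the orientation: the basis contains \<open>Edg i j\<close> for
  \<open>i < j\<close>, while the combinatorial arguments name edges by unordered pairs of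
  endpoints.\<close>

definition edg :: "'v::linorder \<Rightarrow> 'v \<Rightarrow> 'v dm_gen" where
  "edg u v = Edg (min u v) (max u v)"

lemma edg_commute: "edg u v = edg v u"
  by (simp add: edg_def min.commute max.commute)

lemma edg_eq_iff [simp]: "edg a b = edg c d \<longleftrightarrow> {a, b} = {c, d}"
  by (auto simp: edg_def doubleton_eq_iff min_def max_def)

lemma edg_neq_Vtx [simp]: "edg a b \<noteq> Vtx c" "Vtx c \<noteq> edg a b"
  by (simp_all add: edg_def)

lemma gen_verts_edg [simp]: "gen_verts (edg a b) = {a, b}"
  by (auto simp: edg_def min_def max_def)

lemma edg_in_dm_basis: "a \<noteq> b \<Longrightarrow> edg a b \<in> dm_basis G \<longleftrightarrow> {a, b} \<in> edges G"
  by (auto simp: edg_def dm_basis_def min_def max_def insert_commute)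

lemma edge_distinct: "simple_graph G \<Longrightarrow> {a, b} \<in> edges G \<Longrightarrow> a \<noteq> b"
  by (auto simp: simple_graph_def)

lemma edge_verts: "simple_graph G \<Longrightarrow> {a, b} \<in> edges G \<Longrightarrow> a \<in> verts G \<and> b \<in> verts G"
  by (fastforce simp: simple_graph_def doubleton_eq_iff)

lemma dm_basis_cases:
  assumes "simple_graph G" "g \<in> dm_basis G"
  obtains v where "v \<in> verts G" "g = Vtx v"
  | a b where "{a, b} \<in> edges G" "a \<noteq> b" "g = edg a b"
proof (cases g)
  case (Edg i j)
  then have "{i, j} \<in> edges G" "i < j" using assms by (auto simp: dm_basis_def)
  moreover from \<open>i < j\<close> have "g = edg i j" by (simp add: Edg edg_def)
  ultimately show thesis using that(2) by blast
qed (use assms that in \<open>auto simp: dm_basis_def\<close>)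

text \<open>A term of \<open>z\<close> is a monomial with nonzero coefficient. The locale is
  instantiated below with a cocycle and with its modification by a coboundary.\<close>

locale essential_cocycle =
  fixes H :: "'v::linorder graph" and z :: "'v dm_gen ext"
  assumes simple: "simple_graph H"
    and z: "z \<in> cocycles (cochains_on H (verts H)) dm_diff 3"
begin

lemma term_facts:
  assumes "coeff z A \<noteq> 0"
  shows "A \<subseteq> dm_basis H" "(\<Union>g\<in>A. gen_verts g) = verts H" "card A = 3"
  using assms z by (auto simp: cocycles_def cochains_on_eq)

lemma closed: "dm_diff z = 0"
  using z by (simp add: cocycles_def)

text \<open>The basic move between terms: expand an edge of the term \<open>A\<close> into its
  endpoints. The result \<open>B\<close> must also be a boundary term of another term, which arises
  from \<open>B\<close> by contracting a different edge.\<close>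

lemma exchange:
  assumes A: "coeff z A \<noteq> 0" "edg a b \<in> A" "a \<noteq> b" "Vtx a \<notin> A" "Vtx b \<notin> A"
    and B: "B = {Vtx a, Vtx b} \<union> (A - {edg a b})"
  obtains c d where "{c, d} \<in> edges H" "c \<noteq> d" "{c, d} \<noteq> {a, b}" "Vtx c \<in> B" "Vtx d \<in> B"
    "coeff z (insert (edg c d) (B - {Vtx c, Vtx d})) \<noteq> 0"
proof -
  have "diff_support A B"
  proof -
    have "{Vtx a, Vtx b} = {Vtx (min a b), Vtx (max a b)}" by (auto simp: min_def max_def)
    moreover have "Vtx (min a b) \<notin> A" "Vtx (max a b) \<notin> A" "min a b \<noteq> max a b"
      using A by (auto simp: min_def max_def)
    ultimately show ?thesis
      using A(2) B unfolding diff_support_def edg_def by metis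
  qed
  from cocycle_second_term[OF closed A(1) this] obtain A' where
    A': "A' \<noteq> A" "coeff z A' \<noteq> 0" "diff_support A' B" by blast
  from A'(3) obtain i j where ij: "i \<noteq> j" "Edg i j \<in> A'" "Vtx i \<notin> A'" "Vtx j \<notin> A'"
    and B': "B = {Vtx i, Vtx j} \<union> (A' - {Edg i j})"
    unfolding diff_support_def by blast
  have "Edg i j \<in> dm_basis H" using term_facts(1)[OF A'(2)] ij(2) by blast
  then have e: "{i, j} \<in> edges H" "i < j" by (auto simp: dm_basis_def)
  then have edg: "Edg i j = edg i j" by (simp add: edg_def)
  have A'_eq: "A' = insert (edg i j) (B - {Vtx i, Vtx j})"
    using B' ij edg by auto
  have "{i, j} \<noteq> {a, b}"
  proof
    \<comment> \<open>Contracting the same edge again would restore \<open>A\<close>.\<close>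
    assume eq: "{i, j} = {a, b}"
    then have e: "edg i j = edg a b" "{Vtx i, Vtx j} = {Vtx a, Vtx b}" by (auto simp: doubleton_eq_iff)
    have "A' = insert (edg a b) (B - {Vtx a, Vtx b})" unfolding A'_eq e ..
    also have "\<dots> = A" unfolding B using A(2,4,5) by blast
    finally have "A' = A" .
    then show False using A'(1) by simp
  qed
  moreover have "Vtx i \<in> B" "Vtx j \<in> B" unfolding B' by simp_all
  ultimately show thesis using that[OF e(1) ij(1)] A'(2) unfolding A'_eq by blast
qed

lemma has_vertex:
  assumes A: "coeff z A \<noteq> 0"
  shows "\<exists>v. Vtx v \<in> A"
proof (rule ccontr)
  assume no: "\<not> (\<exists>v. Vtx v \<in> A)"
  obtain g where g: "g \<in> A" using term_facts(3)[OF A] by fastforce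
  then have "g \<in> dm_basis H" using term_facts(1)[OF A] by blast
  with simple obtain a b where ab: "a \<noteq> b" "g = edg a b"
    using no g by (cases rule: dm_basis_cases) auto
  obtain c d where "c \<noteq> d" "{c, d} \<noteq> {a, b}" "Vtx c \<in> {Vtx a, Vtx b} \<union> (A - {edg a b})"
    "Vtx d \<in> {Vtx a, Vtx b} \<union> (A - {edg a b})"
    by (rule exchange[OF A _ ab(1) _ _ refl]) (use g ab no in auto)
  then show False using no by auto
qed

text \<open>The cases are zero, one or two edge factors; three are excluded by
  \<open>has_vertex\<close>.\<close>

lemma term_cases:
  assumes A: "coeff z A \<noteq> 0"
  obtains u v w where "A = {Vtx u, Vtx v, Vtx w}" "verts H = {u, v, w}"
  | u v a b where "A = {Vtx u, Vtx v, edg a b}" "u \<noteq> v" "{a, b} \<in> edges H"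
      "verts H = {u, v, a, b}"
  | v a b c d where "A = {Vtx v, edg a b, edg c d}" "{a, b} \<noteq> {c, d}" "{a, b} \<in> edges H"
      "{c, d} \<in> edges H" "verts H = {v, a, b, c, d}"
proof -
  obtain v where v: "Vtx v \<in> A" using has_vertex[OF A] by blast
  have fin: "finite A" using A coeff_infinite by blast
  then have "card (A - {Vtx v}) = 2" using v term_facts(3)[OF A] by simp
  then obtain g h where gh: "A - {Vtx v} = {g, h}" "g \<noteq> h" by (auto simp: card_2_iff)
  then have A_eq: "A = {Vtx v, g, h}" using v by blast
  have V: "verts H = {v} \<union> gen_verts g \<union> gen_verts h"
    using term_facts(2)[OF A] unfolding A_eq by auto
  have g: "g \<in> dm_basis H" and h: "h \<in> dm_basis H" using term_facts(1)[OF A] A_eq by auto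
  show thesis
  proof (rule dm_basis_cases[OF simple g]; rule dm_basis_cases[OF simple h])
    fix u w assume "g = Vtx u" "h = Vtx w"
    then show thesis using that(1)[of v u w] A_eq V by auto
  next
    fix u a b assume "g = Vtx u" "{a, b} \<in> edges H" "h = edg a b"
    then show thesis using that(2)[of v u a b] A_eq V gh by auto
  next
    fix u a b assume "{a, b} \<in> edges H" "g = edg a b" "h = Vtx u"
    then show thesis using that(2)[of v u a b] A_eq V gh by (auto simp: insert_commute)
  next
    fix a b c d assume "{a, b} \<in> edges H" "g = edg a b" "{c, d} \<in> edges H" "h = edg c d"
    then show thesis using that(3)[of v a b c d] A_eq V gh by auto
  qed
qed

section \<open>Five vertices: walks in the Petersen graph\<close>

text \<open>The Petersen graph has the pairs of vertices as its nodes, joined when disjoint, so a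
  term is one of its edges, from \<open>ab\<close> to \<open>cd\<close>. Expanding \<open>cd\<close>
  forces a further term on a different Petersen edge at the node \<open>ab\<close>.\<close>

lemma exchange_disjoint:
  assumes A: "coeff z {Vtx v, edg a b, edg c d} \<noteq> 0" and dist: "distinct [a, b, c, d, v]"
  shows "{a, b} \<in> edges H" "{c, d} \<in> edges H"
    "coeff z {Vtx d, edg a b, edg c v} \<noteq> 0 \<or> coeff z {Vtx c, edg a b, edg d v} \<noteq> 0"
proof -
  show "{a, b} \<in> edges H" "{c, d} \<in> edges H"
    using term_facts(1)[OF A] dist edg_in_dm_basis[of a b H] edg_in_dm_basis[of c d H] by auto
  let ?B = "{Vtx c, Vtx d} \<union> ({Vtx v, edg a b, edg c d} - {edg c d})"
  have B: "?B = {Vtx c, Vtx d, Vtx v, edg a b}" using dist by (auto simp: doubleton_eq_iff)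
  obtain p q where pq: "p \<noteq> q" "{p, q} \<noteq> {c, d}" "Vtx p \<in> ?B" "Vtx q \<in> ?B"
    "coeff z (insert (edg p q) (?B - {Vtx p, Vtx q})) \<noteq> 0"
    by (rule exchange[OF A _ _ _ _ refl, of c d]) (use dist in auto)
  have "p \<in> {c, d, v}" "q \<in> {c, d, v}" using pq(3,4) unfolding B by auto
  then have "{p, q} = {c, v} \<or> {p, q} = {d, v}" using pq(1,2) by auto
  then show "coeff z {Vtx d, edg a b, edg c v} \<noteq> 0 \<or> coeff z {Vtx c, edg a b, edg d v} \<noteq> 0"
  proof
    assume eq: "{p, q} = {c, v}"
    then have "edg p q = edg c v" "{Vtx p, Vtx q} = {Vtx c, Vtx v}" by (auto simp: doubleton_eq_iff)
    moreover have "?B - {Vtx c, Vtx v} = {Vtx d, edg a b}" unfolding B using dist by auto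
    ultimately have "coeff z (insert (edg c v) {Vtx d, edg a b}) \<noteq> 0" using pq(5) by metis
    then show ?thesis by (simp add: insert_commute)
  next
    assume eq: "{p, q} = {d, v}"
    then have "edg p q = edg d v" "{Vtx p, Vtx q} = {Vtx d, Vtx v}" by (auto simp: doubleton_eq_iff)
    moreover have "?B - {Vtx d, Vtx v} = {Vtx c, edg a b}" unfolding B using dist by auto
    ultimately have "coeff z (insert (edg d v) {Vtx c, edg a b}) \<noteq> 0" using pq(5) by metis
    then show ?thesis by (simp add: insert_commute)
  qed
qed

text \<open>A walk \<open>cv - ab - cd - av\<close> of pairs is built and then extended at both
  ends. If an extension reaches \<open>bd\<close>, the edges contain a 5-cycle of \<open>H\<close>;
  otherwise they include \<open>ad\<close> and \<open>cb\<close> and complete K23.\<close>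

lemma listed_if_disjoint_term:
  assumes A: "coeff z {Vtx v, edg a b, edg c d} \<noteq> 0" and dist: "distinct [a, b, c, d, v]"
    and V: "{a, b, c, d, v} = verts H"
  shows "listed H"
proof -
  let ?M = "\<lambda>a b c d v. coeff z {Vtx v, edg a b, edg c d} \<noteq> 0 \<and> distinct [a, b, c, d, v] \<and>
    {a, b, c, d, v} = verts H"
  have swap: "?M b a c d v" "?M a b d c v" "?M c d a b v" if "?M a b c d v" for a b c d v
    using that by (auto simp: edg_commute[of a b] edg_commute[of c d] insert_commute)
  have step: "?M a b c v d \<or> ?M a b d v c" if "?M a b c d v" for a b c d v
    using exchange_disjoint(3)[of v a b c d] that by (auto simp: insert_commute)
  have edge: "{a, b} \<in> edges H" "{c, d} \<in> edges H" if "?M a b c d v" for a b c d v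
    using exchange_disjoint(1,2)[of v a b c d] that by auto
  have M: "?M a b c d v" using assms by blast
  \<comment> \<open>Up to exchanging \<open>c\<close> and \<open>d\<close>, the walk is
    \<open>cd - ab - cv\<close>.\<close>
  obtain c d where 1: "?M a b c d v" "?M a b c v d"
    using step[OF M] M swap(2) by metis
  have "?M c d a v b \<or> ?M c d b v a" by (rule step[OF swap(3)[OF 1(1)]])
  \<comment> \<open>Up to exchanging \<open>a\<close> and \<open>b\<close>, the continuation beyond
    \<open>cd\<close> is \<open>av\<close>.\<close>
  then obtain a b where 2: "?M a b c d v" "?M a b c v d" "?M c d a v b"
    using 1 swap(1) by metis
  have e: "{a, b} \<in> edges H" "{c, d} \<in> edges H" "{c, v} \<in> edges H" "{a, v} \<in> edges H"
    using edge[OF 2(1)] edge(2)[OF 2(2)] edge(2)[OF 2(3)] by auto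
  \<comment> \<open>Extension beyond the end \<open>cv\<close>.\<close>
  have "?M c v a d b \<or> ?M c v b d a" by (rule step[OF swap(3)[OF 2(2)]])
  then have "{a, d} \<in> edges H \<or> {b, d} \<in> edges H" using edge(2) by metis
  \<comment> \<open>Extension beyond the end \<open>av\<close>.\<close>
  moreover have "?M a v c b d \<or> ?M a v d b c" by (rule step[OF swap(3)[OF 2(3)]])
  then have "{c, b} \<in> edges H \<or> {d, b} \<in> edges H" using edge(2) by metis
  ultimately consider "{b, d} \<in> edges H" | "{a, d} \<in> edges H" "{c, b} \<in> edges H"
    by (metis insert_commute)
  then show ?thesis
  proof cases
    case 1
    show ?thesis
      by (rule listed_hamiltonian[OF simple, of a b d c v])
        (use 1 2(1) e in \<open>auto simp: insert_commute\<close>)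
  next
    case ad: 2
    show ?thesis
      by (rule listed_K23[OF simple, of a c b d v])
        (use ad 2(1) e in \<open>auto simp: insert_commute\<close>)
  qed
qed

lemma card_verts_le_4:
  assumes A: "coeff z A \<noteq> 0" and "\<not> listed H"
  shows "card (verts H) \<le> 4"
  using A
proof (cases rule: term_cases)
  case (1 u v w)
  have "card (set [u, v, w]) \<le> length [u, v, w]" by (rule card_length)
  then show ?thesis using 1 by simp
next
  case (2 u v a b)
  have "card (set [u, v, a, b]) \<le> length [u, v, a, b]" by (rule card_length)
  then show ?thesis using 2 by simp
next
  case (3 v a b c d)
  show ?thesis
  proof (rule ccontr)
    assume "\<not> ?thesis"
    moreover have "card (set [a, b, c, d, v]) \<le> length [a, b, c, d, v]" by (rule card_length)
    moreover have V: "{a, b, c, d, v} = verts H" using 3 by auto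
    ultimately have "distinct [a, b, c, d, v]" by (intro card_distinct) simp
    then show False using listed_if_disjoint_term[of v a b c d] 3 V A assms(2) by auto
  qed
qed

text \<open>All graphs on three vertices are listed. On at most two vertices a monomial of degree
  three needs an edge generator, and then the graph is K2, which is listed.\<close>

lemma card_verts_eq_4:
  assumes A: "coeff z A \<noteq> 0" and no: "\<not> listed H"
  shows "card (verts H) = 4"
proof (rule ccontr)
  assume "card (verts H) \<noteq> 4"
  then have le: "card (verts H) \<le> 3" using card_verts_le_4[OF A no] by simp
  have fin: "finite (verts H)" using simple by (simp add: simple_graph_def)
  show False
  proof (cases "card (verts H) = 3")
    case True
    then obtain a b c where "verts H = {a, b, c}" "distinct [a, b, c]" by (auto simp: card_3_iff)
    then show False using listed_3[OF simple, of a b c] no by simp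
  next
    case False
    show False
    proof (cases "edges H = {}")
      case True
      then have "A \<subseteq> Vtx ` verts H" using term_facts(1)[OF A] by (auto simp: dm_basis_def)
      then have "card A \<le> card (verts H)" using fin by (meson card_image_le card_mono finite_imageI le_trans)
      then show False using term_facts(3)[OF A] le False by simp
    next
      case nonempty: False
      then obtain e where e: "e \<in> edges H" by blast
      then obtain a b where "e = {a, b}" "a \<noteq> b" "a \<in> verts H" "b \<in> verts H"
        using simple unfolding simple_graph_def by metis
      with e have ab: "{a, b} \<in> edges H" "a \<noteq> b" "a \<in> verts H" "b \<in> verts H" by simp_all
      have "{a, b} = verts H"
        by (rule card_seteq[OF fin]) (use ab le False in auto)
      then show False using listed_2[OF simple, of a b] ab no by simp
    qed
  qed
qed

section \<open>Four vertices: matchings\<close>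

lemma matching:
  assumes no: "\<not> listed H" and card: "card (verts H) = 4"
    and e: "{x, y} \<in> edges H" "{x, y'} \<in> edges H"
  shows "y = y'"
proof (rule ccontr)
  assume "y \<noteq> y'"
  have fin: "finite (verts H)" using simple by (simp add: simple_graph_def)
  have d: "distinct [y, x, y']" using \<open>y \<noteq> y'\<close> edge_distinct[OF simple] e by auto
  have sub: "{y, x, y'} \<subseteq> verts H" using e edge_verts[OF simple] by auto
  have "card (verts H - {y, x, y'}) = 1"
    using d sub card fin by (subst card_Diff_subset) auto
  then obtain w where w: "verts H - {y, x, y'} = {w}" by (auto simp: card_1_singleton_iff)
  show False
    using listed_4[OF simple, of y x y' w] no d sub w e by (auto simp: insert_commute)
qed

lemma matching_disjoint:
  assumes no: "\<not> listed H" and card: "card (verts H) = 4"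
    and e: "{a, b} \<in> edges H" "{c, d} \<in> edges H" "{a, b} \<noteq> {c, d}"
  shows "{a, b} \<inter> {c, d} = {}"
proof (rule ccontr)
  assume "{a, b} \<inter> {c, d} \<noteq> {}"
  then obtain x where "x \<in> {a, b}" "x \<in> {c, d}" by blast
  then obtain y y' where y: "{a, b} = {x, y}" "{c, d} = {x, y'}" by (auto simp: doubleton_eq_iff)
  then have "y = y'" using matching[OF no card, of x y y'] e by simp
  then show False using y e(3) by simp
qed

text \<open>Terms come in pairs \<open>u v * ab\<close> and \<open>a b * uv\<close>, the two
  boundary terms of the product of the edges \<open>ab\<close> and \<open>uv\<close>. In particular
  \<open>H\<close> is a perfect matching.\<close>

lemma matching_term:
  assumes A: "coeff z A \<noteq> 0" and no: "\<not> listed H"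
  obtains u v a b where "distinct [u, v, a, b]" "verts H = {u, v, a, b}"
    "{a, b} \<in> edges H" "{u, v} \<in> edges H" "A = {Vtx u, Vtx v, edg a b}"
    "coeff z {Vtx a, Vtx b, edg u v} \<noteq> 0"
proof -
  have card: "card (verts H) = 4" by (rule card_verts_eq_4[OF A no])
  note disjoint = matching_disjoint[OF no card]
  \<comment> \<open>Expanding \<open>cd\<close> leaves the vertices \<open>c\<close>,
    \<open>d\<close>, \<open>v\<close>. The edge to contract next is disjoint from
    \<open>cd\<close>, so it would have \<open>v\<close> as both endpoints.\<close>
  have no_matching_term: False if "coeff z {Vtx v, edg a b, edg c d} \<noteq> 0" "{a, b} \<noteq> {c, d}"
      "{a, b} \<in> edges H" "{c, d} \<in> edges H" "v \<in> {a, b}" for v a b c d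
  proof -
    have dist: "distinct [a, b, c, d]"
      using disjoint[OF that(3,4,2)] edge_distinct[OF simple that(3)] edge_distinct[OF simple that(4)]
      by auto
    note A' = that(1) and v = that(5)
    let ?B = "{Vtx c, Vtx d} \<union> ({Vtx v, edg a b, edg c d} - {edg c d})"
    obtain p q where pq: "{p, q} \<in> edges H" "p \<noteq> q" "{p, q} \<noteq> {c, d}" "Vtx p \<in> ?B" "Vtx q \<in> ?B"
      by (rule exchange[OF A' _ _ _ _ refl, of c d]) (use dist v in auto)
    have "p \<in> {c, d, v}" "q \<in> {c, d, v}" using pq(4,5) by auto
    moreover have "{p, q} \<inter> {c, d} = {}" using disjoint[OF pq(1) that(4) pq(3)] .
    ultimately show False using pq(2) by auto
  qed
  show thesis
    using A
  proof (cases rule: term_cases)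
    case (1 u v w)
    have "card (set [u, v, w]) \<le> length [u, v, w]" by (rule card_length)
    then show thesis using 1 card by simp
  next
    case (2 u v a b)
    have dist: "distinct [u, v, a, b]" using 2 card by (intro card_distinct) simp
    let ?B = "{Vtx a, Vtx b} \<union> (A - {edg a b})"
    have B: "?B = {Vtx a, Vtx b, Vtx u, Vtx v}" using 2 by auto
    obtain p q where pq: "{p, q} \<in> edges H" "p \<noteq> q" "{p, q} \<noteq> {a, b}" "Vtx p \<in> ?B" "Vtx q \<in> ?B"
      "coeff z (insert (edg p q) (?B - {Vtx p, Vtx q})) \<noteq> 0"
      by (rule exchange[OF A _ _ _ _ refl, of a b]) (use dist 2 in auto)
    have mem: "p \<in> {a, b, u, v}" "q \<in> {a, b, u, v}" using pq(4,5) unfolding B by auto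
    moreover have "{p, q} \<inter> {a, b} = {}" using disjoint[OF pq(1) 2(3) pq(3)] .
    \<comment> \<open>The contracted edge avoids \<open>a\<close> and \<open>b\<close>, so it joins
      the other two vertices.\<close>
    ultimately have uv: "{p, q} = {u, v}" using pq(2) by auto
    then have "edg p q = edg u v" "{Vtx p, Vtx q} = {Vtx u, Vtx v}" by (auto simp: doubleton_eq_iff)
    moreover have "?B - {Vtx u, Vtx v} = {Vtx a, Vtx b}" unfolding B using dist by auto
    ultimately have "coeff z (insert (edg u v) {Vtx a, Vtx b}) \<noteq> 0" using pq(6) by metis
    then have "coeff z {Vtx a, Vtx b, edg u v} \<noteq> 0" by (simp add: insert_commute)
    moreover have "{u, v} \<in> edges H" using uv pq(1) by simp
    ultimately show thesis using that[OF dist 2(4) 2(3) _ 2(1)] by blast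
  next
    case (3 v a b c d)
    show thesis
    proof (cases "v \<in> {a, b}")
      case True
      then show thesis using no_matching_term[of v a b c d] 3 A by blast
    next
      case False
      have "v \<in> {c, d}"
      proof (rule ccontr)
        assume v: "v \<notin> {c, d}"
        have "distinct [a, b, c, d]"
          using disjoint[OF 3(3,4,2)] edge_distinct[OF simple 3(3)] edge_distinct[OF simple 3(4)]
          by auto
        then have "card {v, a, b, c, d} = 5" using False v by simp
        then show False using 3 card by simp
      qed
      moreover have "A = {Vtx v, edg c d, edg a b}" using 3(1) by auto
      ultimately show thesis using no_matching_term[of v c d a b] 3(2-4) A by metis
    qed
  qed
qed

end

text \<open>In an unlisted graph, subtracting a multiple of \<open>w\<close> from a cocycle
  \<open>z\<close> that is not a coboundary removes the term \<open>A\<close>. The difference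
  \<open>y\<close> is still not a coboundary, but each of its terms forces a nonzero coefficient at
  \<open>A\<close> through the pairing in \<open>matching_term\<close>.\<close>

lemma listed_if_essential_betti:
  assumes H: "simple_graph H" and nonzero: "essential_betti 3 H \<noteq> 0"
  shows "listed H"
proof (rule ccontr)
  assume no: "\<not> listed H"
  let ?Z = "cocycles (cochains_on H (verts H)) dm_diff 3"
  let ?B = "coboundaries (cochains_on H (verts H)) dm_diff 3"
  have BZ: "?B \<subseteq> ?Z" by (rule coboundaries_on_subset_cocycles[OF H])
  have "?Z \<noteq> ?B" using nonzero essential_betti_eq_dim[OF H, of 3] by auto
  then obtain z where z: "z \<in> ?Z" "z \<notin> ?B" using BZ by blast
  interpret z: essential_cocycle H z by standard (use H z in auto)
  have "z \<noteq> 0" using z(2) subspace_0[OF subspace_coboundaries_on] by metis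
  then obtain A where A: "coeff z A \<noteq> 0" by (metis ext_eqI coeff_simps(1))
  obtain u v a b where uvab: "distinct [u, v, a, b]" "verts H = {u, v, a, b}"
    "{a, b} \<in> edges H" "{u, v} \<in> edges H" "A = {Vtx u, Vtx v, edg a b}"
    by (rule z.matching_term[OF A no])
  define w where "w = dm_diff (mono_ext {edg a b, edg u v})"
  have "{edg a b, edg u v} \<subseteq> dm_basis H"
    using uvab edg_in_dm_basis[of a b H] edg_in_dm_basis[of u v H] by simp
  moreover have "card {edg a b, edg u v} = 2" using uvab(1) by (auto simp: doubleton_eq_iff)
  ultimately have "mono_ext {edg a b, edg u v} \<in> cochains_on H (verts H) 2"
    using uvab(2) by (auto simp: cochains_on_eq coeff_mono_ext)
  then have wB: "w \<in> ?B" by (simp add: w_def coboundaries_def numeral_3_eq_3 numeral_2_eq_2)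
  have "diff_support {edg a b, edg u v} {Vtx u, Vtx v, edg a b}"
  proof -
    have "{Vtx u, Vtx v} = {Vtx (min u v), Vtx (max u v)}" by (auto simp: min_def max_def)
    moreover have "min u v \<noteq> max u v" using uvab(1) by (auto simp: min_def max_def)
    moreover have "{edg a b, edg u v} - {edg u v} = {edg a b}" using uvab(1) by (auto simp: doubleton_eq_iff)
    ultimately have "{Vtx u, Vtx v, edg a b} =
        {Vtx (min u v), Vtx (max u v)} \<union> ({edg a b, edg u v} - {Edg (min u v) (max u v)})"
      unfolding edg_def[of u v, symmetric] by auto
    then show ?thesis unfolding diff_support_def using \<open>min u v \<noteq> max u v\<close>
      by (intro exI[of _ "min u v"] exI[of _ "max u v"]) (simp flip: edg_def)
  qed
  then have wA: "coeff w A \<noteq> 0" unfolding w_def uvab(5) by (subst coeff_dm_diff_mono_ext) simp_all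
  \<comment> \<open>The factor makes the coefficients at \<open>A\<close> cancel.\<close>
  define y where "y = z - (coeff z A / coeff w A) *\<^sub>R w"
  have yA: "coeff y A = 0" using wA by (simp add: y_def)
  have "y \<in> ?Z" unfolding y_def
    by (intro subspace_diff subspace_scale subspace_cocycles_on) (use z wB BZ in auto)
  then interpret y: essential_cocycle H y using H by unfold_locales
  have "y \<noteq> 0"
  proof
    assume "y = 0"
    then have "z = (coeff z A / coeff w A) *\<^sub>R w" by (simp add: y_def)
    then show False using z(2) wB subspace_scale[OF subspace_coboundaries_on] by metis
  qed
  then obtain A' where A': "coeff y A' \<noteq> 0" by (metis ext_eqI coeff_simps(1))
  obtain u' v' a' b' where uvab': "distinct [u', v', a', b']" "verts H = {u', v', a', b'}"
    "{a', b'} \<in> edges H" "{u', v'} \<in> edges H" "A' = {Vtx u', Vtx v', edg a' b'}"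
    "coeff y {Vtx a', Vtx b', edg u' v'} \<noteq> 0"
    by (rule y.matching_term[OF A' no])
  have card: "card (verts H) = 4" by (rule z.card_verts_eq_4[OF A no])
  have V: "{u', v', a', b'} = {u, v, a, b}" using uvab(2) uvab'(2) by simp
  \<comment> \<open>A perfect matching on four vertices has just two edges, so the term
    \<open>A'\<close> of \<open>y\<close> is \<open>A\<close> or its partner.\<close>
  have "{a', b'} = {a, b} \<and> {u', v'} = {u, v} \<or> {a', b'} = {u, v} \<and> {u', v'} = {a, b}"
  proof (cases "{a', b'} = {a, b}")
    case True
    have "{u', v'} = verts H - {a', b'}" unfolding uvab'(2) using uvab'(1) by auto
    also have "\<dots> = {u, v}" unfolding True uvab(2) using uvab(1) by auto
    finally show ?thesis using True by blast
  next
    case False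
    then have "{a', b'} \<inter> {a, b} = {}" by (rule z.matching_disjoint[OF no card uvab'(3) uvab(3)])
    moreover have "a' \<in> {u, v, a, b}" "b' \<in> {u, v, a, b}" unfolding V[symmetric] by simp_all
    ultimately have eq: "{a', b'} = {u, v}" using uvab'(1) by auto
    have "{u', v'} = verts H - {a', b'}" unfolding uvab'(2) using uvab'(1) by auto
    also have "\<dots> = {a, b}" unfolding eq uvab(2) using uvab(1) by auto
    finally show ?thesis using eq by blast
  qed
  then show False
  proof
    assume "{a', b'} = {a, b} \<and> {u', v'} = {u, v}"
    then have "edg a' b' = edg a b" "{Vtx u', Vtx v'} = {Vtx u, Vtx v}" by (auto simp: doubleton_eq_iff)
    then have "A' = A" unfolding uvab(5) uvab'(5) by auto
    then show False using A' yA by simp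
  next
    \<comment> \<open>Here \<open>A'\<close> is the partner of \<open>A\<close>, and the coefficient
      supplied by \<open>matching_term\<close> is the one at \<open>A\<close>.\<close>
    assume "{a', b'} = {u, v} \<and> {u', v'} = {a, b}"
    then have "edg u' v' = edg a b" "{Vtx a', Vtx b'} = {Vtx u, Vtx v}" by (auto simp: doubleton_eq_iff)
    then have "{Vtx a', Vtx b', edg u' v'} = A" unfolding uvab(5) by auto
    then show False using uvab'(6) yA by simp
  qed
qed

section \<open>The formula for the third Betti number\<close>

theorem theorem23:
  fixes G :: "'v::linorder graph"
  assumes "simple_graph G"
  shows "betti 3 G = (\<Sum>j=1..23. essential_betti 3 (listed_graph j) * num_induced G (listed_graph j))"
proof -
  let ?b = "\<lambda>j. essential_betti 3 (listed_graph j)"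
  let ?iso = "\<lambda>S j. graph_iso (induced G S) (listed_graph j)"
  have fin: "finite (Pow (verts G))" using assms by (simp add: simple_graph_def)
  \<comment> \<open>At most one listed graph is isomorphic to the induced subgraph, so the sum has
    at most one nonzero summand; for an unlisted subgraph both sides vanish.\<close>
  have "essential_betti 3 (induced G S) = (\<Sum>j=1..23. if ?iso S j then ?b j else 0)"
    if S: "S \<in> Pow (verts G)" for S
  proof (cases "listed (induced G S)")
    case True
    have simple: "simple_graph (induced G S)" using S by (intro simple_induced[OF assms]) simp
    obtain i where i: "i \<in> {1..23}" "?iso S i" using True unfolding listed_def by blast
    have "(\<Sum>j=1..23. if ?iso S j then ?b j else 0) = (\<Sum>j=1..23. if i = j then ?b j else 0)"
    proof (rule sum.cong[OF refl])
      fix j :: nat assume "j \<in> {1..23}"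
      then show "(if ?iso S j then ?b j else 0) = (if i = j then ?b j else 0)"
        using i listed_graph_iso_unique[of i j "induced G S"] by auto
    qed
    also have "\<dots> = ?b i" using i(1) by (simp add: sum.delta)
    also have "\<dots> = essential_betti 3 (induced G S)"
      by (rule essential_betti_iso[OF simple simple_listed_graph[OF i(1)] i(2), symmetric])
    finally show ?thesis by (rule sym)
  next
    case False
    have "essential_betti 3 (induced G S) = 0"
      using listed_if_essential_betti[OF simple_induced[OF assms, of S]] S False by blast
    moreover have "\<not> ?iso S j" if "j \<in> {1..23}" for j using False that unfolding listed_def by blast
    then have "(\<Sum>j=1..23. if ?iso S j then ?b j else 0) = 0" by (intro sum.neutral) simp
    ultimately show ?thesis by simp
  qed
  then have "betti 3 G = (\<Sum>S\<in>Pow (verts G). \<Sum>j=1..23. if ?iso S j then ?b j else 0)"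
    unfolding betti_eq_sum_essential_betti[OF assms] by (rule sum.cong[OF refl])
  \<comment> \<open>After the exchange, index \<open>j\<close> contributes its essential Betti
    number once for each induced copy of the graph.\<close>
  also have "\<dots> = (\<Sum>j=1..23. \<Sum>S\<in>Pow (verts G). if ?iso S j then ?b j else 0)"
    by (rule sum.swap)
  also have "\<dots> = (\<Sum>j=1..23. ?b j * num_induced G (listed_graph j))"
  proof (rule sum.cong[OF refl])
    fix j :: nat
    have "(\<Sum>S\<in>Pow (verts G). if ?iso S j then ?b j else 0) = (\<Sum>S\<in>{S \<in> Pow (verts G). ?iso S j}. ?b j)"
      by (rule sum.inter_filter[OF fin, symmetric])
    then show "(\<Sum>S\<in>Pow (verts G). if ?iso S j then ?b j else 0) = ?b j * num_induced G (listed_graph j)"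
      by (simp add: num_induced_def)
  qed
  finally show ?thesis .
qed

end
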